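(* Let $(U(t,s))_{t\ge s}$ be an evolution family on a real separable Hilbert space $\mathbb{H}$, and let $(\mu_{t,s})_{t\ge s}$ be infinitely divisible probability measures on $\mathbb{H}$, $\mu_{t,s}=[a_{t,s},R_{t,s},m_{t,s}]$, with $\mu_{t,s}=\mu_{t,r}*(\mu_{r,s}\circ U(t,r)^{-1})$ for all $t\ge r\ge s$. Let $p_{s,t}f(x)=\int_{\mathbb{H}}f(U(t,s)x+y)\,\mu_{t,s}(dy)$ and $\Gamma_{t,s}=R_{t,s}^{-1/2}U(t,s)$. Then for every $\alpha>1$, $t\ge s$ and every bounded non-negative Borel function $f$ on $\mathbb{H}$, $$(p_{s,t}f(x))^\alpha\le\exp\Bigl(\frac{\alpha|\Gamma_{t,s}(x-y)|^2}{2(\alpha-1)}\Bigr)\,p_{s,t}f^\alpha(y),\qquad x,y\in\mathbb{H}.$$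
   Context: Evolution family: bounded linear operators $U(t,s)$, $t\ge s$, on $\mathbb{H}$ with $U(s,s)=I$, $U(t,r)U(r,s)=U(t,s)$ for $t\ge r\ge s$, and $(t,s)\mapsto U(t,s)x$ continuous for each $x$. $\mu=[a,R,m]$ means that $\mu$ is infinitely divisible with $\int e^{i\langle x,\xi\rangle}\mu(dx)=e^{-\psi(\xi)}$, $\psi(\xi)=-i\langle a,\xi\rangle+\frac12\langle R\xi,\xi\rangle-\int_{\mathbb{H}}\bigl(e^{i\langle\xi,x\rangle}-1-\frac{i\langle\xi,x\rangle}{1+|x|^2}\bigr)m(dx)$, where $a\in\mathbb{H}$, $R$ is a non-negative symmetric trace class operator and $m$ is a Lévy measure. $R_{t,s}^{-1/2}$ is the pseudo-inverse of $R_{t,s}^{1/2}$ and $\Gamma_{t,s}$ has domain $\{x\in\mathbb{H}: U(t,s)x\in R_{t,s}^{1/2}(\mathbb{H})\}$; for $x$ outside this domain $|\Gamma_{t,s}x|:=\infty$, in which case the right-hand side of the inequality is understood as $+\infty$. *)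

theory Defs
  imports "HOL-Probability.Probability"
begin

text \<open>
  A real separable Hilbert space is a type of sort
  \<open>{real_inner, complete_space, second_countable_topology}\<close>. Families indexed by pairs
  of times are total functions \<open>real \<Rightarrow> real \<Rightarrow> _\<close>, the later time first;
  nothing is assumed about their values at \<open>(t, s)\<close> with \<open>t < s\<close>.
\<close>

definition evolution_family :: "(real \<Rightarrow> real \<Rightarrow> 'a::real_normed_vector \<Rightarrow>\<^sub>L 'a) \<Rightarrow> bool" where
  "evolution_family U \<longleftrightarrow>
     (\<forall>s. U s s = id_blinfun) \<and>
     (\<forall>t r s. s \<le> r \<longrightarrow> r \<le> t \<longrightarrow> U t r o\<^sub>L U r s = U t s) \<and>
     (\<forall>x. continuous_on {(t, s). s \<le> t} (\<lambda>(t, s). blinfun_apply (U t s) x))"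

definition borel_prob :: "'a::topological_space measure \<Rightarrow> bool" where
  "borel_prob \<mu> \<longleftrightarrow> prob_space \<mu> \<and> sets \<mu> = sets borel"

text \<open>
  The library's \<open>convolution\<close> is restricted to \<open>ordered_euclidean_space\<close>; this is the same
  definition on an arbitrary Borel additive structure.
\<close>

definition conv :: "'a::{topological_space, plus} measure \<Rightarrow> 'a measure \<Rightarrow> 'a measure" where
  "conv \<mu> \<nu> = distr (\<mu> \<Otimes>\<^sub>M \<nu>) borel (\<lambda>(x, y). x + y)"

definition infinitely_divisible :: "'a::{topological_space, monoid_add} measure \<Rightarrow> bool" where
  "infinitely_divisible \<mu> \<longleftrightarrow>
     borel_prob \<mu> \<and> (\<forall>n\<ge>1. \<exists>\<nu>. borel_prob \<nu> \<and> \<mu> = (conv \<nu> ^^ n) (return borel 0))"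

definition nonneg_symmetric :: "('a::real_inner \<Rightarrow>\<^sub>L 'a) \<Rightarrow> bool" where
  "nonneg_symmetric R \<longleftrightarrow>
     (\<forall>x y. blinfun_apply R x \<bullet> y = x \<bullet> blinfun_apply R y) \<and>
     (\<forall>x. 0 \<le> blinfun_apply R x \<bullet> x)"

text \<open>
  Trace class in the sense of nuclear operators: \<open>T x = (\<Sum>j. \<langle>b j, x\<rangle> a j)\<close> with
  \<open>(\<Sum>j. |a j| |b j|) < \<infinity>\<close>.
\<close>

definition trace_class :: "('a::real_inner \<Rightarrow>\<^sub>L 'a) \<Rightarrow> bool" where
  "trace_class T \<longleftrightarrow>
     (\<exists>a b :: nat \<Rightarrow> 'a. summable (\<lambda>j. norm (a j) * norm (b j)) \<and>
        (\<forall>x. (\<lambda>j. (b j \<bullet> x) *\<^sub>R a j) sums blinfun_apply T x))"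

definition levy_measure :: "'a::real_normed_vector measure \<Rightarrow> bool" where
  "levy_measure m \<longleftrightarrow>
     sets m = sets borel \<and> emeasure m {0} = 0 \<and>
     (\<integral>\<^sup>+x. ennreal (min 1 ((norm x)\<^sup>2)) \<partial>m) < \<infinity>"

definition levy_symbol ::
    "'a::real_inner \<Rightarrow> ('a \<Rightarrow>\<^sub>L 'a) \<Rightarrow> 'a measure \<Rightarrow> 'a \<Rightarrow> complex" where
  "levy_symbol a R m \<xi> =
     - \<i> * of_real (a \<bullet> \<xi>) + of_real (blinfun_apply R \<xi> \<bullet> \<xi>) / 2
     - (\<integral>x. (iexp (\<xi> \<bullet> x) - 1 - \<i> * of_real (\<xi> \<bullet> x) / of_real (1 + (norm x)\<^sup>2)) \<partial>m)"

text \<open>\<open>has_levy_triplet \<mu> a R m\<close> is \<open>\<mu> = [a, R, m]\<close>.\<close>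

definition has_levy_triplet ::
    "'a::real_inner measure \<Rightarrow> 'a \<Rightarrow> ('a \<Rightarrow>\<^sub>L 'a) \<Rightarrow> 'a measure \<Rightarrow> bool" where
  "has_levy_triplet \<mu> a R m \<longleftrightarrow>
     infinitely_divisible \<mu> \<and> nonneg_symmetric R \<and> trace_class R \<and> levy_measure m \<and>
     (\<forall>\<xi>. (\<integral>x. iexp (x \<bullet> \<xi>) \<partial>\<mu>) = exp (- levy_symbol a R m \<xi>))"

text \<open>
  On a Hilbert space a non-negative symmetric operator has exactly one non-negative symmetric
  square root, so the choice below is no choice.
\<close>

definition op_sqrt :: "('a::real_inner \<Rightarrow>\<^sub>L 'a) \<Rightarrow> ('a \<Rightarrow>\<^sub>L 'a)" where
  "op_sqrt R = (SOME S. nonneg_symmetric S \<and> S o\<^sub>L S = R)"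

text \<open>
  The inverse of the restriction of \<open>T\<close> to the orthogonal complement of its kernel;
  it is meaningful on \<open>range (blinfun_apply T)\<close> only.
\<close>

definition pseudo_inverse :: "('a::real_inner \<Rightarrow>\<^sub>L 'b::real_normed_vector) \<Rightarrow> 'b \<Rightarrow> 'a" where
  "pseudo_inverse T = inv_into ({z. blinfun_apply T z = 0}\<^sup>\<bottom>) (blinfun_apply T)"

definition Gamma_dom ::
    "(real \<Rightarrow> real \<Rightarrow> 'a::real_inner \<Rightarrow>\<^sub>L 'a) \<Rightarrow> (real \<Rightarrow> real \<Rightarrow> 'a \<Rightarrow>\<^sub>L 'a) \<Rightarrow>
     real \<Rightarrow> real \<Rightarrow> 'a set" where
  "Gamma_dom U R t s =
     {x. blinfun_apply (U t s) x \<in> range (blinfun_apply (op_sqrt (R t s)))}"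

text \<open>Meaningful on \<open>Gamma_dom U R t s\<close> only.\<close>

definition Gamma_op ::
    "(real \<Rightarrow> real \<Rightarrow> 'a::real_inner \<Rightarrow>\<^sub>L 'a) \<Rightarrow> (real \<Rightarrow> real \<Rightarrow> 'a \<Rightarrow>\<^sub>L 'a) \<Rightarrow>
     real \<Rightarrow> real \<Rightarrow> 'a \<Rightarrow> 'a" where
  "Gamma_op U R t s x = pseudo_inverse (op_sqrt (R t s)) (blinfun_apply (U t s) x)"

text \<open>\<open>mehler U \<mu> s t f x\<close> is \<open>p\<^sub>s\<^sub>,\<^sub>t f (x)\<close>; note the order of the times.\<close>

definition mehler ::
    "(real \<Rightarrow> real \<Rightarrow> 'a::real_normed_vector \<Rightarrow>\<^sub>L 'a) \<Rightarrow> (real \<Rightarrow> real \<Rightarrow> 'a measure) \<Rightarrow>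
     real \<Rightarrow> real \<Rightarrow> ('a \<Rightarrow> real) \<Rightarrow> 'a \<Rightarrow> real" where
  "mehler U \<mu> s t f x = (\<integral>y. f (blinfun_apply (U t s) x + y) \<partial>(\<mu> t s))"

end

theory Submission
  imports Defs
begin

text \<open>
  Fix \<open>s \<le> t\<close> and put \<open>\<mu> = \<mu>\<^sub>t\<^sub>,\<^sub>s = [a, R, m]\<close>. If \<open>U(t, s)(x - y) = R\<^sup>1\<^sup>/\<^sup>2 z\<close> with \<open>z = \<Gamma>\<^sub>t\<^sub>,\<^sub>s(x - y)\<close>,
  then \<open>p\<^sub>s\<^sub>,\<^sub>t f (x)\<close> is the integral of \<open>g = f(U(t, s) y + _)\<close> over a copy of \<open>\<mu>\<close> shifted by
  \<open>R\<^sup>1\<^sup>/\<^sup>2 z\<close>, and the claim becomes a statement about the single measure \<open>\<mu>\<close>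
  (\<open>shift_power_inequality\<close>).

  A shift by \<open>R\<^sup>1\<^sup>/\<^sup>2 z\<close> only concerns one direction of the noise. With \<open>e = z / |z|\<close> and
  \<open>k = R\<^sup>1\<^sup>/\<^sup>2 e\<close> the form \<open>\<langle>R \<xi>, \<xi>\<rangle> - \<langle>k, \<xi>\<rangle>\<^sup>2\<close> is still non-negative, so morally
  \<open>\<mu> = \<nu> * law(\<sigma> k)\<close> with a standard normal real \<open>\<sigma>\<close> and an infinitely divisible \<open>\<nu>\<close>. On the one
  Gaussian coordinate the shift by \<open>|z|\<close> has the density \<open>exp(|z| \<sigma> - |z|\<^sup>2 / 2)\<close>, and Young's
  inequality, the linear form of Hoelder's, gives
  \<open>\<integral> g(w + |z| k) \<mu>(dw) \<le> (\<tau>/\<alpha>) \<integral> g\<^sup>\<alpha> d\<mu> + \<tau>\<^bsup>1-\<beta>\<^esup> E / \<beta>\<close> for all \<open>\<tau> > 0\<close>, where \<open>\<beta>\<close> is the exponent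
  conjugate to \<open>\<alpha>\<close> and \<open>E\<close> is the \<open>\<beta>\<close>-th moment of the density. Optimising over \<open>\<tau>\<close> produces
  exactly the constant of the theorem.

  The measure \<open>\<nu>\<close> is never constructed, which would require the existence half of the
  Levy-Khintchine theorem on a Hilbert space. What is used of \<open>\<nu>\<close> is only that integration against it
  is a positive functional on trigonometric polynomials, and this is a property of its
  characteristic function alone: the quotient of the characteristic functions of \<open>\<mu>\<close> and
  \<open>law(\<sigma> k)\<close> lies in the closed cone generated by the characters (\<open>character_positive\<close>). That cone
  is closed under products, limits and exponentials, so the Levy-Khintchine exponent can be treated
  by pointwise approximation (\<open>character_positive_levy_quotient\<close>). The inequality for
  trigonometric polynomials then reaches all bounded non-negative Borel functions, because the former
  are \<open>L\<^sup>1\<close>-dense for \<open>\<mu>\<close> and its shift simultaneously (\<open>bounded_borel_approximable\<close>).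

  Two facts about operators make \<open>\<Gamma>\<close> meaningful: a non-negative symmetric operator has a
  non-negative symmetric square root, and every point in the range of an operator has a preimage
  orthogonal to the kernel.
\<close>

section \<open>Square roots and pseudo-inverses of operators\<close>

text \<open>
  Expand the non-negative number \<open>\<langle>R(x - R x), x - R x\<rangle>\<close>; its quadratic term is at most \<open>|R x|\<^sup>2\<close>.
\<close>

lemma nonneg_symmetric_norm_sq_le:
  assumes "nonneg_symmetric R" "norm R \<le> 1"
  shows "(norm (blinfun_apply R x))\<^sup>2 \<le> blinfun_apply R x \<bullet> x"
proof -
  have sym: "R u \<bullet> v = u \<bullet> R v" for u v
    using assms(1) unfolding nonneg_symmetric_def by blast
  have nn: "0 \<le> R (x - R x) \<bullet> (x - R x)"
    using assms(1) unfolding nonneg_symmetric_def by blast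
  have "R (R x) \<bullet> R x \<le> norm (R (R x)) * norm (R x)" by (rule norm_cauchy_schwarz)
  also have "norm (R (R x)) \<le> 1 * norm (R x)"
    using norm_blinfun[of R "R x"] mult_right_mono[OF assms(2) norm_ge_zero[of "R x"]] by linarith
  finally have b: "R (R x) \<bullet> R x \<le> (norm (R x))\<^sup>2"
    by (simp add: power2_eq_square mult_right_mono)
  have "R (x - R x) \<bullet> (x - R x) = R x \<bullet> x - 2 * (R x \<bullet> R x) + R (R x) \<bullet> R x"
    using sym[of "R x" x] by (simp add: blinfun.diff_right inner_diff algebra_simps)
  then show ?thesis using nn b by (simp add: power2_norm_eq_inner)
qed

lemma norm_id_minus_nonneg_symmetric_le_1:
  assumes "nonneg_symmetric R" "norm R \<le> 1"
  shows "norm (id_blinfun - R) \<le> 1"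
proof (rule norm_blinfun_bound, simp)
  fix x
  have "(norm (x - R x))\<^sup>2 = (norm x)\<^sup>2 - 2 * (R x \<bullet> x) + (norm (R x))\<^sup>2"
    by (simp add: power2_norm_eq_inner inner_diff inner_commute algebra_simps)
  also have "\<dots> \<le> (norm x)\<^sup>2"
    using nonneg_symmetric_norm_sq_le[OF assms, of x] assms(1)
    unfolding nonneg_symmetric_def by (smt (verit))
  finally show "norm ((id_blinfun - R) x) \<le> 1 * norm x"
    by (simp add: blinfun.diff_left power2_le_iff_abs_le)
qed

text \<open>
  If \<open>Y\<close> solves \<open>Y = (B + Y\<^sup>2) / 2\<close> with \<open>B = I - R\<close>, then \<open>(I - Y)\<^sup>2 = R\<close>. This is the Picard
  iteration for that equation; \<open>sqrt_majorant\<close> is the same iteration for the number \<open>B = 1\<close>. Its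
  increments dominate the norms of the operator increments, which gives convergence even when
  \<open>|B| = 1\<close>, where the iteration need not be a contraction.
\<close>

primrec sqrt_iter :: "('a::real_normed_vector \<Rightarrow>\<^sub>L 'a) \<Rightarrow> nat \<Rightarrow> 'a \<Rightarrow>\<^sub>L 'a" where
  "sqrt_iter B 0 = 0"
| "sqrt_iter B (Suc n) = (1/2) *\<^sub>R (B + (sqrt_iter B n o\<^sub>L sqrt_iter B n))"

primrec sqrt_majorant :: "nat \<Rightarrow> real" where
  "sqrt_majorant 0 = 0"
| "sqrt_majorant (Suc n) = (1 + (sqrt_majorant n)\<^sup>2) / 2"

lemma sqrt_majorant_bounds: "0 \<le> sqrt_majorant n \<and> sqrt_majorant n \<le> 1"
  by (induction n) (auto simp: power_le_one)

lemma sqrt_majorant_Suc: "sqrt_majorant n \<le> sqrt_majorant (Suc n)"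
  using zero_le_power2[of "1 - sqrt_majorant n"] by (simp add: power2_eq_square algebra_simps)

lemma norm_sqrt_iter_le:
  assumes "norm B \<le> 1"
  shows "norm (sqrt_iter B n) \<le> sqrt_majorant n"
proof (induction n)
  case (Suc n)
  have "norm (sqrt_iter B n o\<^sub>L sqrt_iter B n) \<le> (sqrt_majorant n)\<^sup>2"
    using norm_blinfun_compose[of "sqrt_iter B n" "sqrt_iter B n"] power_mono[OF Suc norm_ge_zero, of 2]
    by (simp add: power2_eq_square)
  then show ?case
    using norm_triangle_ineq[of B "sqrt_iter B n o\<^sub>L sqrt_iter B n"] assms by simp
qed simp

text \<open>
  The identity \<open>Y\<^sup>2 - Z\<^sup>2 = Y (Y - Z) + (Y - Z) Z\<close> reproduces, in norm, the recursion for the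
  increments of the majorant.
\<close>

lemma norm_sqrt_iter_step_le:
  assumes "norm B \<le> 1"
  shows "norm (sqrt_iter B (Suc n) - sqrt_iter B n) \<le> sqrt_majorant (Suc n) - sqrt_majorant n"
proof (induction n)
  case 0
  then show ?case using assms by simp
next
  case (Suc n)
  let ?Y = "sqrt_iter B (Suc n)" and ?Z = "sqrt_iter B n"
  let ?y = "sqrt_majorant (Suc n)" and ?z = "sqrt_majorant n"
  have "sqrt_iter B (Suc (Suc n)) - ?Y
      = (1/2) *\<^sub>R ((?Y o\<^sub>L (?Y - ?Z)) + ((?Y - ?Z) o\<^sub>L ?Z))"
  proof -
    have "sqrt_iter B (Suc (Suc n)) - ?Y
        = (1/2) *\<^sub>R (B + (?Y o\<^sub>L ?Y)) - (1/2) *\<^sub>R (B + (?Z o\<^sub>L ?Z))"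
      by (rule arg_cong2[where f = minus]) (rule sqrt_iter.simps(2))+
    also have "\<dots> = (1/2) *\<^sub>R ((?Y o\<^sub>L (?Y - ?Z)) + ((?Y - ?Z) o\<^sub>L ?Z))"
      by (rule blinfun_eqI)
        (simp add: blinfun.add_left blinfun.diff_left blinfun.scaleR_left
          blinfun.diff_right algebra_simps del: sqrt_iter.simps)
    finally show ?thesis .
  qed
  also have "norm \<dots> \<le> (1/2) * (?y * (?y - ?z) + (?y - ?z) * ?z)"
  proof -
    have "norm (?Y o\<^sub>L (?Y - ?Z)) \<le> ?y * (?y - ?z)"
      by (rule order_trans[OF norm_blinfun_compose])
         (intro mult_mono norm_sqrt_iter_le assms Suc norm_ge_zero; use sqrt_majorant_bounds in blast)
    moreover have "norm ((?Y - ?Z) o\<^sub>L ?Z) \<le> (?y - ?z) * ?z"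
      by (rule order_trans[OF norm_blinfun_compose])
         (intro mult_mono norm_sqrt_iter_le assms Suc norm_ge_zero; use sqrt_majorant_Suc in simp)
    ultimately show ?thesis
      using norm_triangle_ineq[of "?Y o\<^sub>L (?Y - ?Z)" "(?Y - ?Z) o\<^sub>L ?Z"]
      by (simp del: sqrt_iter.simps sqrt_majorant.simps)
  qed
  also have "\<dots> = sqrt_majorant (Suc (Suc n)) - ?y"
  proof -
    have "sqrt_majorant (Suc (Suc n)) - ?y = (1 + ?y\<^sup>2) / 2 - (1 + ?z\<^sup>2) / 2"
      by (rule arg_cong2[where f = minus]) (rule sqrt_majorant.simps(2))+
    then show ?thesis
      by (simp add: power2_eq_square algebra_simps diff_divide_distrib add_divide_distrib
            del: sqrt_majorant.simps)
  qed
  finally show ?case .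
qed

lemma sqrt_iter_symmetric:
  assumes "\<And>x y. blinfun_apply B x \<bullet> y = x \<bullet> blinfun_apply B y"
  shows "blinfun_apply (sqrt_iter B n) x \<bullet> y = x \<bullet> blinfun_apply (sqrt_iter B n) y"
  by (induction n arbitrary: x y)
     (simp_all add: assms blinfun.add_left blinfun.scaleR_left inner_add)

text \<open>
  Convergence is stated pointwise: the bounded operators are complete in norm, but pointwise limits
  are all that the construction of the root needs.
\<close>

lemma sqrt_iter_convergent:
  fixes B :: "'a::{real_inner, complete_space} \<Rightarrow>\<^sub>L 'a"
  assumes B: "norm B \<le> 1"
  shows "convergent (\<lambda>n. blinfun_apply (sqrt_iter B n) x)"
proof -
  let ?y = sqrt_majorant
  have inc: "incseq ?y" by (intro incseq_SucI sqrt_majorant_Suc)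
  have step: "norm (sqrt_iter B (n + j) x - sqrt_iter B n x) \<le> (?y (n + j) - ?y n) * norm x" for n j
  proof (induction j)
    case (Suc j)
    have "norm (sqrt_iter B (Suc (n + j)) x - sqrt_iter B (n + j) x)
        \<le> (?y (Suc (n + j)) - ?y (n + j)) * norm x"
      using norm_blinfun[of "sqrt_iter B (Suc (n + j)) - sqrt_iter B (n + j)" x]
        mult_right_mono[OF norm_sqrt_iter_step_le[OF B, of "n + j"] norm_ge_zero[of x]]
      by (simp add: blinfun.diff_left del: sqrt_iter.simps sqrt_majorant.simps)
    then show ?case
      using Suc norm_triangle_ineq[of "sqrt_iter B (Suc (n + j)) x - sqrt_iter B (n + j) x"
          "sqrt_iter B (n + j) x - sqrt_iter B n x"]
      by (simp add: algebra_simps del: sqrt_iter.simps sqrt_majorant.simps)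
  qed simp
  have "convergent ?y"
    by (rule Bseq_mono_convergent[OF BseqI'[of _ 1]])
       (use inc sqrt_majorant_bounds in \<open>auto simp: incseq_def\<close>)
  then have cy: "Cauchy (\<lambda>n. ?y n * norm x)"
    by (intro convergent_Cauchy convergent_mult convergent_const)
  have "Cauchy (\<lambda>n. sqrt_iter B n x)"
  proof (rule CauchyI')
    fix e :: real assume "0 < e"
    then obtain M where M: "\<And>m n. m \<ge> M \<Longrightarrow> n \<ge> M \<Longrightarrow> norm (?y m * norm x - ?y n * norm x) < e"
      using CauchyD[OF cy] by blast
    show "\<exists>M. \<forall>m\<ge>M. \<forall>n>m. dist (sqrt_iter B m x) (sqrt_iter B n x) < e"
    proof (intro exI allI impI)
      fix m n assume "M \<le> m" "m < n"
      then have "norm (?y n * norm x - ?y m * norm x) < e" using M by simp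
      moreover obtain j where "n = m + j" using \<open>m < n\<close> less_imp_add_positive by blast
      ultimately show "dist (sqrt_iter B m x) (sqrt_iter B n x) < e"
        using step[of m j] by (simp add: dist_norm norm_minus_commute algebra_simps)
    qed
  qed
  then show ?thesis by (rule Cauchy_convergent)
qed

text \<open>
  The pointwise limit \<open>Y\<close> of the iteration inherits linearity, symmetry and \<open>|Y x| \<le> |x|\<close>; the last
  property makes \<open>I - Y\<close> non-negative.
\<close>

lemma sqrt_exists_contraction:
  fixes R :: "'a::{real_inner, complete_space} \<Rightarrow>\<^sub>L 'a"
  assumes R: "nonneg_symmetric R" and n1: "norm R \<le> 1"
  shows "\<exists>S. nonneg_symmetric S \<and> S o\<^sub>L S = R"
proof -
  define B where "B = id_blinfun - R"
  have B: "norm B \<le> 1"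
    unfolding B_def by (rule norm_id_minus_nonneg_symmetric_le_1[OF R n1])
  have Bsym: "B x \<bullet> y = x \<bullet> B y" for x y
    using R unfolding B_def nonneg_symmetric_def by (simp add: blinfun.diff_left inner_diff)
  define Y where "Y x = lim (\<lambda>n. sqrt_iter B n x)" for x
  have lim: "(\<lambda>n. sqrt_iter B n x) \<longlonglongrightarrow> Y x" for x
    unfolding Y_def using sqrt_iter_convergent[OF B] by (simp add: convergent_LIMSEQ_iff)
  have iter_le: "norm (sqrt_iter B n x) \<le> norm x" for n x
  proof -
    have "norm (sqrt_iter B n) \<le> 1"
      using norm_sqrt_iter_le[OF B, of n] sqrt_majorant_bounds[of n] by linarith
    then show ?thesis
      using norm_blinfun[of "sqrt_iter B n" x] mult_right_mono[of "norm (sqrt_iter B n)" 1 "norm x"]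
      by simp
  qed
  have Yle: "norm (Y x) \<le> norm x" for x
    by (rule LIMSEQ_le_const2[OF tendsto_norm[OF lim]]) (use iter_le in blast)
  have Yadd: "Y (x + y) = Y x + Y y" for x y
    by (rule LIMSEQ_unique[OF lim]) (simp add: blinfun.add_right tendsto_add lim)
  have Yscale: "Y (r *\<^sub>R x) = r *\<^sub>R Y x" for r x
    by (rule LIMSEQ_unique[OF lim]) (simp add: blinfun.scaleR_right tendsto_scaleR lim)
  have bl: "bounded_linear Y"
    by (rule bounded_linear_intro[where K = 1]) (use Yadd Yscale Yle in auto)
  have Ydiff: "Y (x - y) = Y x - Y y" for x y
    using bl by (simp add: linear_diff bounded_linear.linear)
  have Ysym: "Y x \<bullet> y = x \<bullet> Y y" for x y
    by (rule LIMSEQ_unique[OF tendsto_inner[OF lim tendsto_const]])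
       (simp add: sqrt_iter_symmetric[OF Bsym] tendsto_inner lim)
  have fix_eq: "Y x = (1/2) *\<^sub>R (B x + Y (Y x))" for x
  proof -
    have "(\<lambda>n. sqrt_iter B n (sqrt_iter B n x)) \<longlonglongrightarrow> Y (Y x)"
    proof -
      have "(\<lambda>n. sqrt_iter B n (sqrt_iter B n x - Y x)) \<longlonglongrightarrow> 0"
      proof (rule tendsto_norm_zero_cancel, rule tendsto_sandwich[of "\<lambda>_. 0"])
        show "(\<lambda>n. norm (sqrt_iter B n x - Y x)) \<longlonglongrightarrow> 0"
          using tendsto_norm_zero[OF LIM_zero[OF lim]] .
      qed (use iter_le in auto)
      from tendsto_add[OF this lim[of "Y x"]] show ?thesis
        by (simp add: blinfun.diff_right)
    qed
    then have "(\<lambda>n. sqrt_iter B (Suc n) x) \<longlonglongrightarrow> (1/2) *\<^sub>R (B x + Y (Y x))"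
      by (auto simp: blinfun.add_left blinfun.scaleR_left intro!: tendsto_intros)
    then show ?thesis using LIMSEQ_unique[OF LIMSEQ_Suc[OF lim]] by blast
  qed
  define S where "S = Blinfun (\<lambda>x. x - Y x)"
  have S: "S x = x - Y x" for x
    unfolding S_def by (subst bounded_linear_Blinfun_apply)
      (auto intro!: bounded_linear_sub bounded_linear_ident bl)
  have "nonneg_symmetric S"
    unfolding nonneg_symmetric_def S
  proof (intro conjI allI)
    fix x y show "(x - Y x) \<bullet> y = x \<bullet> (y - Y y)" by (simp add: inner_diff Ysym)
    have "Y x \<bullet> x \<le> norm (Y x) * norm x" by (rule norm_cauchy_schwarz)
    also have "\<dots> \<le> norm x * norm x" by (intro mult_right_mono Yle) simp
    finally show "0 \<le> (x - Y x) \<bullet> x"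
      by (simp add: inner_diff power2_norm_eq_inner[symmetric] power2_eq_square)
  qed
  moreover have "S o\<^sub>L S = R"
  proof (rule blinfun_eqI)
    fix x
    have "Y x + Y x = B x + Y (Y x)"
      by (subst (1 2) fix_eq) (metis scaleR_half_double scaleR_right_distrib)
    then have "Y (Y x) = Y x + Y x - B x" by simp
    then show "(S o\<^sub>L S) x = R x"
      by (simp add: S Ydiff B_def blinfun.diff_left)
  qed
  ultimately show ?thesis by blast
qed

lemma nonneg_symmetric_scaleR:
  assumes "nonneg_symmetric R" "0 \<le> r"
  shows "nonneg_symmetric (r *\<^sub>R R)"
proof -
  have sym: "R x \<bullet> y = x \<bullet> R y" and nn: "0 \<le> R x \<bullet> x" for x y
    using assms(1) unfolding nonneg_symmetric_def by blast+
  have "(r *\<^sub>R R) x \<bullet> y = x \<bullet> (r *\<^sub>R R) y" for x y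
    by (simp add: blinfun.scaleR_left sym)
  moreover have "0 \<le> (r *\<^sub>R R) x \<bullet> x" for x
    using mult_nonneg_nonneg[OF assms(2) nn[of x]] by (simp add: blinfun.scaleR_left)
  ultimately show ?thesis unfolding nonneg_symmetric_def by blast
qed

lemma sqrt_exists:
  fixes R :: "'a::{real_inner, complete_space} \<Rightarrow>\<^sub>L 'a"
  assumes R: "nonneg_symmetric R"
  shows "\<exists>S. nonneg_symmetric S \<and> S o\<^sub>L S = R"
proof -
  define r where "r = norm R + 1"
  have r: "0 < r" "norm R \<le> r" unfolding r_def by (auto simp: add_nonneg_pos)
  have "nonneg_symmetric ((1/r) *\<^sub>R R)"
    by (rule nonneg_symmetric_scaleR[OF R]) (use r in simp)
  moreover have "norm ((1/r) *\<^sub>R R) \<le> 1" using r by simp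
  ultimately obtain S where S: "nonneg_symmetric S" "S o\<^sub>L S = (1/r) *\<^sub>R R"
    using sqrt_exists_contraction by blast
  have "nonneg_symmetric (sqrt r *\<^sub>R S)"
    by (rule nonneg_symmetric_scaleR[OF S(1)]) (use r in simp)
  moreover have "(sqrt r *\<^sub>R S) o\<^sub>L (sqrt r *\<^sub>R S) = R"
  proof (rule blinfun_eqI)
    fix x
    have "((sqrt r *\<^sub>R S) o\<^sub>L (sqrt r *\<^sub>R S)) x = r *\<^sub>R (S o\<^sub>L S) x"
      using r by (simp add: blinfun.scaleR_left blinfun.scaleR_right)
    then show "((sqrt r *\<^sub>R S) o\<^sub>L (sqrt r *\<^sub>R S)) x = R x"
      using r by (simp add: S(2) blinfun.scaleR_left)
  qed
  ultimately show ?thesis by blast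
qed

lemma op_sqrt_properties:
  fixes R :: "'a::{real_inner, complete_space} \<Rightarrow>\<^sub>L 'a"
  assumes "nonneg_symmetric R"
  shows "nonneg_symmetric (op_sqrt R)" "op_sqrt R o\<^sub>L op_sqrt R = R"
  using someI_ex[OF sqrt_exists[OF assms]] unfolding op_sqrt_def by auto

text \<open>
  A minimising sequence in the closed affine set of preimages is Cauchy by the parallelogram law.
\<close>

lemma minimal_norm_preimage:
  fixes T :: "'a::{real_inner, complete_space} \<Rightarrow>\<^sub>L 'b::real_normed_vector"
  assumes "k \<in> range (blinfun_apply T)"
  shows "\<exists>z. blinfun_apply T z = k \<and> (\<forall>w. blinfun_apply T w = k \<longrightarrow> norm z \<le> norm w)"
proof -
  define C where "C = {z. T z = k}"
  have C: "C \<noteq> {}" using assms unfolding C_def by auto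
  define d where "d = Inf (norm ` C)"
  have bdd: "bdd_below (norm ` C)" by (rule bdd_belowI[of _ 0]) auto
  have d: "d \<le> norm w" if "w \<in> C" for w
    unfolding d_def by (rule cInf_lower[OF _ bdd]) (use that in auto)
  have d0: "0 \<le> d" unfolding d_def by (rule cInf_greatest) (use C in auto)
  have "\<exists>w\<in>C. norm w < d + 1 / real (Suc n)" for n
    using cInf_lessD[of "norm ` C" "d + 1 / real (Suc n)"] C unfolding d_def by auto
  then obtain w where w: "\<And>n. w n \<in> C" "\<And>n. norm (w n) < d + 1 / real (Suc n)" by metis
  define b where "b n = (d + 1 / real (Suc n))\<^sup>2 - d\<^sup>2" for n
  have lim1: "(\<lambda>n. d + 1 / real (Suc n)) \<longlonglongrightarrow> d"
    using tendsto_add[OF tendsto_const[of d] LIMSEQ_inverse_real_of_nat] by (simp add: inverse_eq_divide)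
  have "(\<lambda>n. b n) \<longlonglongrightarrow> d\<^sup>2 - d\<^sup>2"
    unfolding b_def by (intro tendsto_diff tendsto_power lim1 tendsto_const)
  then have blim: "b \<longlonglongrightarrow> 0" by simp
  have close: "(norm (w m - w n))\<^sup>2 \<le> 2 * b m + 2 * b n" for m n
  proof -
    have "(1/2) *\<^sub>R (w m + w n) \<in> C"
      using w(1)[of m] w(1)[of n] unfolding C_def
      by (simp add: blinfun.add_right blinfun.scaleR_right scaleR_half_double)
    then have "d\<^sup>2 \<le> (norm ((1/2) *\<^sub>R (w m + w n)))\<^sup>2" 
      by (intro power_mono d d0)
    then have "4 * d\<^sup>2 \<le> (norm (w m + w n))\<^sup>2" by (simp add: power_divide)
    moreover have "(norm (w j))\<^sup>2 \<le> (d + 1 / real (Suc j))\<^sup>2" for j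
      using w(2)[of j] by (intro power_mono) auto
    moreover have "(norm (w m + w n))\<^sup>2 + (norm (w m - w n))\<^sup>2 = 2 * (norm (w m))\<^sup>2 + 2 * (norm (w n))\<^sup>2"
      by (simp add: power2_norm_eq_inner inner_add inner_diff inner_commute)
    ultimately show ?thesis unfolding b_def by (smt (verit))
  qed
  have "Cauchy w"
  proof (rule CauchyI)
    fix e :: real assume "0 < e"
    then have "\<forall>\<^sub>F n in sequentially. b n < e\<^sup>2 / 4"
      using order_tendstoD(2)[OF blim, of "e\<^sup>2 / 4"] by simp
    then obtain N where N: "\<And>n. n \<ge> N \<Longrightarrow> b n < e\<^sup>2 / 4" by (auto simp: eventually_sequentially)
    have "norm (w m - w n) < e" if "m \<ge> N" "n \<ge> N" for m n
    proof -
      have "(norm (w m - w n))\<^sup>2 < e\<^sup>2" using close[of m n] N[OF that(1)] N[OF that(2)] by linarith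
      then show ?thesis using \<open>0 < e\<close> power_less_imp_less_base by fastforce
    qed
    then show "\<exists>M. \<forall>m\<ge>M. \<forall>n\<ge>M. norm (w m - w n) < e" by blast
  qed
  then obtain z where z: "w \<longlonglongrightarrow> z" using Cauchy_convergent convergentD by blast
  have "(\<lambda>n. T (w n)) \<longlonglongrightarrow> T z" by (intro tendsto_intros z)
  then have "T z = k" using w(1) LIMSEQ_unique[OF _ tendsto_const] unfolding C_def by force
  moreover have "norm z \<le> d"
    by (rule LIMSEQ_le[OF tendsto_norm[OF z] lim1]) (use w(2) less_imp_le in blast)
  ultimately show ?thesis using d unfolding C_def by force
qed

text \<open>
  A preimage of minimal norm is orthogonal to the kernel, since otherwise subtracting its component
  along a kernel vector would shorten it.
\<close>

lemma pseudo_inverse_preimage: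
  fixes T :: "'a::{real_inner, complete_space} \<Rightarrow>\<^sub>L 'b::real_normed_vector"
  assumes "k \<in> range (blinfun_apply T)"
  shows "blinfun_apply T (pseudo_inverse T k) = k"
proof -
  obtain z where z: "T z = k" and min: "\<And>w. T w = k \<Longrightarrow> norm z \<le> norm w"
    using minimal_norm_preimage[OF assms] by blast
  have "orthogonal z y" if "T y = 0" for y
  proof (rule ccontr)
    assume no: "\<not> orthogonal z y"
    then have y: "y \<noteq> 0" by (auto simp: orthogonal_def)
    \<comment> \<open>the length-minimising multiple of \<open>y\<close> to subtract\<close>
    define c where "c = (z \<bullet> y) / (y \<bullet> y)"
    have "T (z - c *\<^sub>R y) = k" by (simp add: blinfun.diff_right blinfun.scaleR_right z that)
    from power_mono[OF min[OF this], of 2]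
    have "z \<bullet> z \<le> (z - c *\<^sub>R y) \<bullet> (z - c *\<^sub>R y)" by (simp add: power2_norm_eq_inner)
    also have "\<dots> = z \<bullet> z - (z \<bullet> y)\<^sup>2 / (y \<bullet> y)"
      using y unfolding c_def by (simp add: inner_diff inner_commute field_simps power2_eq_square)
    finally have "(z \<bullet> y)\<^sup>2 / (y \<bullet> y) \<le> 0" by simp
    moreover have "0 < (z \<bullet> y)\<^sup>2 / (y \<bullet> y)"
      using no y by (simp add: orthogonal_def)
    ultimately show False by simp
  qed
  then have "z \<in> {z. T z = 0}\<^sup>\<bottom>" by (simp add: orthogonal_comp_def orthogonal_commute)
  then have "k \<in> blinfun_apply T ` ({z. T z = 0}\<^sup>\<bottom>)" using z by blast
  then show ?thesis unfolding pseudo_inverse_def by (rule f_inv_into_f)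
qed

section \<open>The cone generated by the characters\<close>

text \<open>
  A list of coefficients and frequencies stands for a trigonometric polynomial. Pairing it with the
  character of a point evaluates the polynomial there; pairing it with the characteristic function
  of a measure integrates it.
\<close>

definition pairing :: "(complex \<times> 'a) list \<Rightarrow> ('a \<Rightarrow> complex) \<Rightarrow> complex" where
  "pairing ps \<phi> = (\<Sum>(c, \<xi>)\<leftarrow>ps. c * \<phi> \<xi>)"

definition character :: "'a::real_inner \<Rightarrow> 'a \<Rightarrow> complex" where
  "character x \<xi> = iexp (\<xi> \<bullet> x)"

text \<open>
  By duality these functions form the closed convex cone generated by the characters of points. It
  takes the place of the characteristic functions of finite measures, with the advantage of being
  trivially closed under pointwise limits.
\<close>

definition character_positive :: "('a::real_inner \<Rightarrow> complex) \<Rightarrow> bool" where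
  "character_positive \<phi> \<longleftrightarrow>
     (\<forall>ps. (\<forall>x. 0 \<le> Re (pairing ps (character x))) \<longrightarrow> 0 \<le> Re (pairing ps \<phi>))"

lemma character_add: "character (x + y) = (\<lambda>\<xi>. character x \<xi> * character y \<xi>)"
  by (simp add: fun_eq_iff character_def inner_add_right exp_add distrib_left)

lemma character_0 [simp]: "character 0 = (\<lambda>\<xi>. 1)"
  by (simp add: character_def fun_eq_iff)

lemma norm_character [simp]: "cmod (character x \<xi>) = 1"
  by (simp add: character_def)

lemma pairing_simps [simp]:
  "pairing [] \<phi> = 0" "pairing ((c, \<xi>) # ps) \<phi> = c * \<phi> \<xi> + pairing ps \<phi>"
  "pairing (ps @ qs) \<phi> = pairing ps \<phi> + pairing qs \<phi>"
  by (simp_all add: pairing_def)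

lemma pairing_add: "pairing ps (\<lambda>\<xi>. \<phi> \<xi> + \<eta> \<xi>) = pairing ps \<phi> + pairing ps \<eta>"
  by (induction ps) (auto simp: algebra_simps)

lemma pairing_scale: "pairing ps (\<lambda>\<xi>. r * \<phi> \<xi>) = r * pairing ps \<phi>"
  by (induction ps) (auto simp: algebra_simps)

lemma pairing_modulate:
  "pairing (map (\<lambda>(c, \<xi>). (c * \<eta> \<xi>, \<xi>)) ps) \<phi> = pairing ps (\<lambda>\<xi>. \<eta> \<xi> * \<phi> \<xi>)"
  by (induction ps) (auto simp: algebra_simps)

lemma pairing_tendsto:
  assumes "\<And>\<xi>. (\<lambda>n. X n \<xi>) \<longlonglongrightarrow> \<phi> \<xi>"
  shows "(\<lambda>n. pairing ps (X n)) \<longlonglongrightarrow> pairing ps \<phi>"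
  by (induction ps) (auto intro!: tendsto_intros assms)

lemma pairing_integral:
  assumes "\<And>\<xi>. integrable M (\<lambda>y. g y \<xi>)"
  shows "integrable M (\<lambda>y. pairing ps (g y))"
    and "(\<integral>y. pairing ps (g y) \<partial>M) = pairing ps (\<lambda>\<xi>. \<integral>y. g y \<xi> \<partial>M)"
proof -
  have "integrable M (\<lambda>y. pairing ps (g y)) \<and>
      (\<integral>y. pairing ps (g y) \<partial>M) = pairing ps (\<lambda>\<xi>. \<integral>y. g y \<xi> \<partial>M)"
    by (induction ps) (auto simp: assms)
  then show "integrable M (\<lambda>y. pairing ps (g y))"
    and "(\<integral>y. pairing ps (g y) \<partial>M) = pairing ps (\<lambda>\<xi>. \<integral>y. g y \<xi> \<partial>M)" by auto
qed

lemma character_positiveD: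
  "character_positive \<phi> \<Longrightarrow> (\<And>x. 0 \<le> Re (pairing ps (character x))) \<Longrightarrow> 0 \<le> Re (pairing ps \<phi>)"
  unfolding character_positive_def by blast

lemma character_positive_character: "character_positive (character x)"
  unfolding character_positive_def by blast

lemma character_positive_add:
  "character_positive \<phi> \<Longrightarrow> character_positive \<eta> \<Longrightarrow> character_positive (\<lambda>\<xi>. \<phi> \<xi> + \<eta> \<xi>)"
  unfolding character_positive_def by (auto simp: pairing_add intro!: add_nonneg_nonneg)

lemma character_positive_scale:
  assumes "character_positive \<phi>" "0 \<le> r"
  shows "character_positive (\<lambda>\<xi>. of_real r * \<phi> \<xi>)"
  using assms unfolding character_positive_def by (auto simp: pairing_scale)

lemma character_positive_const: "0 \<le> r \<Longrightarrow> character_positive (\<lambda>\<xi>. of_real r)"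
  using character_positive_scale[OF character_positive_character[of 0], of r] by simp

text \<open>
  This is the counterpart of convolution. For fixed \<open>x\<close> the polynomial \<open>y \<mapsto> p(x + y)\<close> is non-negative,
  so pairing with \<open>\<eta>\<close> gives a non-negative polynomial in \<open>x\<close>, to which \<open>\<phi>\<close> is applied.
\<close>

lemma character_positive_mult:
  assumes \<phi>: "character_positive \<phi>" and \<eta>: "character_positive \<eta>"
  shows "character_positive (\<lambda>\<xi>. \<phi> \<xi> * \<eta> \<xi>)"
  unfolding character_positive_def
proof (intro allI impI)
  fix ps :: "(complex \<times> 'a) list"
  assume nonneg: "\<forall>x. 0 \<le> Re (pairing ps (character x))"
  have "0 \<le> Re (pairing (map (\<lambda>(c, \<xi>). (c * \<eta> \<xi>, \<xi>)) ps) (character x))" for x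
  proof -
    have "0 \<le> Re (pairing (map (\<lambda>(c, \<xi>). (c * character x \<xi>, \<xi>)) ps) (character y))" for y
      using nonneg[rule_format, of "x + y"] by (simp add: pairing_modulate character_add)
    from character_positiveD[OF \<eta> this] show ?thesis
      by (simp add: pairing_modulate mult.commute)
  qed
  from character_positiveD[OF \<phi> this] show "0 \<le> Re (pairing ps (\<lambda>\<xi>. \<phi> \<xi> * \<eta> \<xi>))"
    by (simp add: pairing_modulate mult.commute)
qed

lemma character_positive_limit:
  assumes "\<And>n. character_positive (X n)" "\<And>\<xi>. (\<lambda>n. X n \<xi>) \<longlonglongrightarrow> \<phi> \<xi>"
  shows "character_positive \<phi>"
  unfolding character_positive_def
proof (intro allI impI)
  fix ps :: "(complex \<times> 'a) list"
  assume "\<forall>x. 0 \<le> Re (pairing ps (character x))"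
  then have "0 \<le> Re (pairing ps (X n))" for n using assms(1) character_positiveD by blast
  then show "0 \<le> Re (pairing ps \<phi>)"
    using LIMSEQ_le_const[OF tendsto_Re[OF pairing_tendsto[of X \<phi>]]] assms(2) by blast
qed

lemma integrable_character:
  fixes h :: "'b \<Rightarrow> 'a::{real_inner, second_countable_topology}"
  assumes "finite_measure M" "h \<in> measurable M borel"
  shows "integrable M (\<lambda>y. character (h y) \<xi>)"
proof -
  interpret finite_measure M by fact
  show ?thesis
    by (rule integrable_const_bound[where B = 1]) (use assms(2) in \<open>auto simp: character_def\<close>)
qed

lemma integral_Re_pairing:
  fixes h :: "'b \<Rightarrow> 'a::{real_inner, second_countable_topology}"
  assumes "finite_measure M" "h \<in> measurable M borel"
  shows "(\<integral>y. Re (pairing ps (character (h y))) \<partial>M) = Re (pairing ps (\<lambda>\<xi>. \<integral>y. character (h y) \<xi> \<partial>M))"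
  by (subst integral_Re)
    (auto simp: pairing_integral[of M "\<lambda>y. character (h y)", OF integrable_character[OF assms]])

lemma character_positive_integral:
  fixes h :: "'b \<Rightarrow> 'a::{real_inner, second_countable_topology}"
  assumes "finite_measure M" "h \<in> measurable M borel"
  shows "character_positive (\<lambda>\<xi>. \<integral>y. character (h y) \<xi> \<partial>M)"
  unfolding character_positive_def integral_Re_pairing[OF assms, symmetric] by simp

lemma character_positive_prod:
  assumes "finite B" "\<And>b. b \<in> B \<Longrightarrow> character_positive (X b)"
  shows "character_positive (\<lambda>\<xi>. \<Prod>b\<in>B. X b \<xi>)"
  using assms
proof (induction B)
  case empty
  then show ?case using character_positive_const[of 1] by simp
next
  case (insert b B)
  then show ?case by (simp add: character_positive_mult)
qed

text \<open>
  The partial sums of the exponential series stay in the cone: this is the compound Poisson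
  construction.
\<close>

lemma character_positive_exp:
  assumes "character_positive \<phi>"
  shows "character_positive (\<lambda>\<xi>. exp (\<phi> \<xi>))"
proof (rule character_positive_limit)
  have pow: "character_positive (\<lambda>\<xi>. \<phi> \<xi> ^ k)" for k
  proof (induction k)
    case 0
    then show ?case using character_positive_const[of 1] by simp
  next
    case (Suc k)
    then show ?case using character_positive_mult[OF assms Suc] by simp
  qed
  show "character_positive (\<lambda>\<xi>. \<Sum>k<n. \<phi> \<xi> ^ k /\<^sub>R fact k)" for n
  proof (induction n)
    case 0
    then show ?case using character_positive_const[of 0] by simp
  next
    case (Suc n)
    have "character_positive (\<lambda>\<xi>. \<phi> \<xi> ^ n /\<^sub>R fact n)"
      using character_positive_scale[OF pow[of n], of "inverse (fact n)"]
      by (simp add: scaleR_conv_of_real)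
    from character_positive_add[OF Suc this] show ?case by simp
  qed
  show "(\<lambda>n. \<Sum>k<n. \<phi> \<xi> ^ k /\<^sub>R fact k) \<longlonglongrightarrow> exp (\<phi> \<xi>)" for \<xi>
    using exp_converges[of "\<phi> \<xi>"] unfolding sums_def .
qed

lemma integral_character_std_normal:
  fixes v :: "'a::{real_inner, second_countable_topology}"
  shows "(\<integral>\<sigma>. character (\<sigma> *\<^sub>R v) \<xi> \<partial>std_normal_distribution) = of_real (exp (- (\<xi> \<bullet> v)\<^sup>2 / 2))"
  using fun_cong[OF char_std_normal_distribution, of "\<xi> \<bullet> v"]
  by (simp add: char_def character_def mult.commute)

lemma character_positive_gauss:
  fixes v :: "'a::{real_inner, second_countable_topology}"
  shows "character_positive (\<lambda>\<xi>. of_real (exp (- (\<xi> \<bullet> v)\<^sup>2 / 2)))"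
proof -
  interpret G: real_distribution std_normal_distribution
    by (rule real_dist_normal_dist)
  show ?thesis
    unfolding integral_character_std_normal[symmetric]
    by (rule character_positive_integral) (auto intro: G.finite_measure_axioms)
qed

section \<open>Gaussian exponents\<close>

definition orthonormal :: "'a::real_inner set \<Rightarrow> bool" where
  "orthonormal B \<longleftrightarrow> finite B \<and> (\<forall>b\<in>B. norm b = 1) \<and> (\<forall>b\<in>B. \<forall>c\<in>B. b \<noteq> c \<longrightarrow> b \<bullet> c = 0)"

text \<open>
  For orthonormal \<open>B\<close> this is the component orthogonal to the span of \<open>B\<close>.
\<close>

definition residual :: "'a::real_inner set \<Rightarrow> 'a \<Rightarrow> 'a" where
  "residual B w = w - (\<Sum>b\<in>B. (b \<bullet> w) *\<^sub>R b)"

lemma orthonormalD: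
  assumes "orthonormal B"
  shows "finite B" "b \<in> B \<Longrightarrow> b \<bullet> b = 1" "b \<in> B \<Longrightarrow> c \<in> B \<Longrightarrow> b \<noteq> c \<Longrightarrow> b \<bullet> c = 0"
  using assms by (simp_all add: orthonormal_def norm_eq_1)

lemma inner_residual:
  assumes "orthonormal B" "c \<in> B"
  shows "c \<bullet> residual B w = 0"
proof -
  have fin: "finite B" by (rule orthonormalD(1)[OF assms(1)])
  have "c \<bullet> (\<Sum>b\<in>B. (b \<bullet> w) *\<^sub>R b) = (\<Sum>b\<in>B. if b = c then c \<bullet> w else 0)"
    unfolding inner_sum_right
  proof (rule sum.cong)
    fix b assume b: "b \<in> B"
    show "c \<bullet> ((b \<bullet> w) *\<^sub>R b) = (if b = c then c \<bullet> w else 0)"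
      using orthonormalD(2)[OF assms(1) b] orthonormalD(3)[OF assms(1) b assms(2)] by (cases "b = c") (auto simp: inner_commute)
  qed simp
  also have "\<dots> = c \<bullet> w" using fin assms(2) by (simp only: sum.delta) simp
  finally show ?thesis by (simp add: residual_def inner_diff_right)
qed

lemma norm_residual:
  assumes "orthonormal B"
  shows "(norm (residual B w))\<^sup>2 = (norm w)\<^sup>2 - (\<Sum>b\<in>B. (b \<bullet> w)\<^sup>2)"
proof -
  let ?r = "residual B w"
  have "?r \<bullet> (\<Sum>b\<in>B. (b \<bullet> w) *\<^sub>R b) = (\<Sum>b\<in>B. (b \<bullet> w) * (b \<bullet> ?r))"
    by (simp add: inner_sum_right inner_commute)
  then have "?r \<bullet> (\<Sum>b\<in>B. (b \<bullet> w) *\<^sub>R b) = 0"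
    by (simp add: inner_residual[OF assms])
  moreover have "?r \<bullet> ?r = ?r \<bullet> w - ?r \<bullet> (\<Sum>b\<in>B. (b \<bullet> w) *\<^sub>R b)"
    by (simp only: residual_def inner_diff_right)
  moreover have "?r \<bullet> w = w \<bullet> w - (\<Sum>b\<in>B. (b \<bullet> w)\<^sup>2)"
    unfolding residual_def by (simp add: inner_diff_left inner_sum_left power2_eq_square)
  ultimately show ?thesis by (simp only: power2_norm_eq_inner diff_zero)
qed

lemma residual_diff: "residual B (v - w) = residual B v - residual B w"
  unfolding residual_def by (simp add: inner_diff_right scaleR_left_diff_distrib sum_subtractf)

text \<open>
  Gram-Schmidt; vanishing of the residual expresses that the span has reached a vector.
\<close>

lemma orthonormal_extend:
  assumes "finite W" "orthonormal C"
  shows "\<exists>B. orthonormal B \<and> C \<subseteq> B \<and> (\<forall>w\<in>W. residual B w = 0)"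
  using assms(1)
proof (induction W)
  case empty
  then show ?case using assms(2) by auto
next
  case (insert d W)
  then obtain B where B: "orthonormal B" "C \<subseteq> B" and W: "\<And>w. w \<in> W \<Longrightarrow> residual B w = 0"
    by blast
  show ?case
  proof (cases "residual B d = 0")
    case True
    then show ?thesis using B W by blast
  next
    case False
    define r where "r = residual B d"
    define b where "b = r /\<^sub>R norm r"
    have orth: "c \<bullet> b = 0" if "c \<in> B" for c
      using inner_residual[OF B(1) that, of d] unfolding b_def r_def by simp
    have nb: "norm b = 1" unfolding b_def r_def using False by simp
    have fin: "finite B" by (rule orthonormalD(1)[OF B(1)])
    have bB: "b \<notin> B" using orth[of b] nb by (auto simp: norm_eq_1)
    have ins: "residual (insert b B) w = residual B w - (b \<bullet> w) *\<^sub>R b" for w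
      using fin bB unfolding residual_def by simp
    have orth': "b \<bullet> c = 0" if "c \<in> B" for c
      using orth[OF that] by (simp add: inner_commute)
    have "orthonormal (insert b B)"
      using B(1) nb orth orth' by (simp add: orthonormal_def)
    moreover have bw: "b \<bullet> w = b \<bullet> residual B w" for w
      using orth' unfolding residual_def by (simp add: inner_diff_right inner_sum_right)
    have "residual (insert b B) w = 0" if "w \<in> insert d W" for w
    proof (cases "w = d")
      case True
      have r0: "norm r \<noteq> 0" using \<open>residual B d \<noteq> 0\<close> unfolding r_def by simp
      have "b \<bullet> d = (r \<bullet> r) / norm r"
        using bw[of d] unfolding r_def[symmetric] unfolding b_def by (simp add: inverse_eq_divide)
      also have "\<dots> = norm r"
        using r0 by (simp add: power2_norm_eq_inner[symmetric] power2_eq_square)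
      finally have "(b \<bullet> d) *\<^sub>R b = r" unfolding b_def using r0 by simp
      then show ?thesis unfolding True ins by (simp add: r_def)
    next
      case False
      then have "residual B w = 0" using that W by blast
      then show ?thesis using bw[of w] unfolding ins by simp
    qed
    ultimately show ?thesis using B(2) by blast
  qed
qed

text \<open>
  Parseval's identity as a limit over finite orthonormal sets, all containing a prescribed
  one. The spans of the sets absorb a countable dense sequence, and the residual of \<open>w\<close> is no larger
  than the distance from \<open>w\<close> to any vector already absorbed.
\<close>

lemma orthonormal_exhaustion:
  fixes C :: "'a::{real_inner, second_countable_topology} set"
  assumes "orthonormal C"
  shows "\<exists>B. (\<forall>n. orthonormal (B n) \<and> C \<subseteq> B n) \<and>
           (\<forall>w. (\<lambda>n. \<Sum>b\<in>B n. (b \<bullet> w)\<^sup>2) \<longlonglongrightarrow> (norm w)\<^sup>2)"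
proof -
  obtain D :: "'a set" where D: "countable D" "\<And>X. open X \<Longrightarrow> X \<noteq> {} \<Longrightarrow> \<exists>d\<in>D. d \<in> X"
    using countable_dense_setE by blast
  have "D \<noteq> {}" using D(2)[of UNIV] by auto
  define d where "d = from_nat_into D"
  have "\<exists>B. orthonormal B \<and> C \<subseteq> B \<and> (\<forall>w\<in>d ` {..n}. residual B w = 0)" for n
    by (rule orthonormal_extend[OF _ assms]) simp
  then have "\<forall>n. \<exists>B. orthonormal B \<and> C \<subseteq> B \<and> (\<forall>w\<in>d ` {..n}. residual B w = 0)" by blast
  from choice[OF this] obtain B where
    "\<forall>n. orthonormal (B n) \<and> C \<subseteq> B n \<and> (\<forall>w\<in>d ` {..n}. residual (B n) w = 0)" by blast
  then have B: "\<And>n. orthonormal (B n)" "\<And>n. C \<subseteq> B n"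
    "\<And>n i. i \<le> n \<Longrightarrow> residual (B n) (d i) = 0" by auto
  have "(\<lambda>n. \<Sum>b\<in>B n. (b \<bullet> w)\<^sup>2) \<longlonglongrightarrow> (norm w)\<^sup>2" for w
  proof (rule LIMSEQ_I)
    fix e :: real assume e: "0 < e"
    have "ball w (sqrt e) \<noteq> {}" using e by simp
    then obtain x where "x \<in> D" "x \<in> ball w (sqrt e)" using D(2) open_ball by blast
    then obtain i where i: "norm (w - d i) < sqrt e"
      using from_nat_into_surj[OF D(1)] unfolding d_def by (metis dist_norm mem_ball)
    have "norm ((\<Sum>b\<in>B n. (b \<bullet> w)\<^sup>2) - (norm w)\<^sup>2) < e" if "i \<le> n" for n
    proof -
      have "(norm w)\<^sup>2 - (\<Sum>b\<in>B n. (b \<bullet> w)\<^sup>2) = (norm (residual (B n) (w - d i)))\<^sup>2"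
        by (simp add: norm_residual[OF B(1)] residual_diff B(3)[OF that])
      also have "\<dots> \<le> (norm (w - d i))\<^sup>2"
        unfolding norm_residual[OF B(1)] by (simp add: sum_nonneg)
      also have "\<dots> < (sqrt e)\<^sup>2" by (rule power_strict_mono[OF i]) auto
      finally have "(norm w)\<^sup>2 - (\<Sum>b\<in>B n. (b \<bullet> w)\<^sup>2) < e" using e by simp
      moreover have "0 \<le> (norm w)\<^sup>2 - (\<Sum>b\<in>B n. (b \<bullet> w)\<^sup>2)"
        unfolding norm_residual[OF B(1), symmetric] by simp
      ultimately show ?thesis by simp
    qed
    then show "\<exists>N. \<forall>n\<ge>N. norm ((\<Sum>b\<in>B n. (b \<bullet> w)\<^sup>2) - (norm w)\<^sup>2) < e" by blast
  qed
  then show ?thesis using B by blast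
qed

text \<open>
  The Gaussian exponent of \<open>S\<^sup>2\<close> remains admissible after the direction \<open>S e\<close> is removed: by Parseval
  \<open>|S \<xi>|\<^sup>2\<close> is the sum of the squares \<open>\<langle>\<xi>, S b\<rangle>\<^sup>2\<close> over an orthonormal basis containing \<open>e\<close>, and the term of
  \<open>e\<close> is dropped. The value \<open>e = 0\<close> is allowed so that a trivial shift is not a separate case.
\<close>

lemma character_positive_gauss_remainder:
  fixes S :: "'a::{real_inner, second_countable_topology} \<Rightarrow>\<^sub>L 'a"
  assumes sym: "\<And>x y. blinfun_apply S x \<bullet> y = x \<bullet> blinfun_apply S y" and e: "e = 0 \<or> norm e = 1"
  shows "character_positive (\<lambda>\<xi>. of_real (exp (- ((norm (S \<xi>))\<^sup>2 - (\<xi> \<bullet> S e)\<^sup>2) / 2)))"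
proof -
  have "orthonormal (if e = 0 then {} else {e})" using e by (auto simp: orthonormal_def)
  from orthonormal_exhaustion[OF this] obtain B where
    B': "\<forall>n. orthonormal (B n) \<and> (if e = 0 then {} else {e}) \<subseteq> B n"
    and lim: "\<forall>w. (\<lambda>n. \<Sum>b\<in>B n. (b \<bullet> w)\<^sup>2) \<longlonglongrightarrow> (norm w)\<^sup>2"
    by (elim exE conjE)
  have B: "orthonormal (B n)" "e \<noteq> 0 \<Longrightarrow> e \<in> B n" for n
    using B'[rule_format, of n] by simp_all
  have fin: "finite (B n)" for n by (rule orthonormalD(1)[OF B(1)])
  have split: "(\<Sum>b\<in>B n - {e}. (\<xi> \<bullet> S b)\<^sup>2) = (\<Sum>b\<in>B n. (b \<bullet> S \<xi>)\<^sup>2) - (\<xi> \<bullet> S e)\<^sup>2" for n \<xi>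
  proof -
    have "(\<Sum>b\<in>B n - {e}. (\<xi> \<bullet> S b)\<^sup>2) = (\<Sum>b\<in>B n. (\<xi> \<bullet> S b)\<^sup>2) - (\<xi> \<bullet> S e)\<^sup>2"
      using fin[of n] B(2)[of n] by (cases "e = 0") (auto simp: sum_diff1)
    moreover have "\<xi> \<bullet> S b = b \<bullet> S \<xi>" for b
      using sym[of b \<xi>] inner_commute[of \<xi> "S b"] by simp
    ultimately show ?thesis by simp
  qed
  show ?thesis
  proof (rule character_positive_limit)
    show "character_positive (\<lambda>\<xi>. \<Prod>b\<in>B n - {e}. of_real (exp (- (\<xi> \<bullet> S b)\<^sup>2 / 2)))" for n
      using fin by (intro character_positive_prod character_positive_gauss) auto
    fix \<xi>
    have "(\<lambda>n. complex_of_real (exp (- (((\<Sum>b\<in>B n. (b \<bullet> S \<xi>)\<^sup>2) - (\<xi> \<bullet> S e)\<^sup>2)) / 2)))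
        \<longlonglongrightarrow> of_real (exp (- ((norm (S \<xi>))\<^sup>2 - (\<xi> \<bullet> S e)\<^sup>2) / 2))"
      by (intro tendsto_intros lim[rule_format]) auto
    moreover have "(\<Prod>b\<in>B n - {e}. complex_of_real (exp (- (\<xi> \<bullet> S b)\<^sup>2 / 2)))
        = of_real (exp (- (((\<Sum>b\<in>B n. (b \<bullet> S \<xi>)\<^sup>2) - (\<xi> \<bullet> S e)\<^sup>2)) / 2))" for n
      using fin[of n] unfolding split[symmetric]
      by (simp add: exp_sum[symmetric] sum_negf sum_divide_distrib flip: of_real_prod)
    ultimately show "(\<lambda>n. \<Prod>b\<in>B n - {e}. of_real (exp (- (\<xi> \<bullet> S b)\<^sup>2 / 2)))
        \<longlonglongrightarrow> complex_of_real (exp (- ((norm (S \<xi>))\<^sup>2 - (\<xi> \<bullet> S e)\<^sup>2) / 2))"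
      by simp
  qed
qed

section \<open>Levy exponents\<close>

text \<open>
  Integrability of the Levy-Khintchine integrand, and of the square of its compensator, near the
  origin and at infinity at once.
\<close>

lemma levy_integrand_bound:
  fixes x \<xi> :: "'a::real_inner"
  defines "v \<equiv> (\<xi> \<bullet> x) / (1 + (norm x)\<^sup>2)"
  shows "cmod (iexp (\<xi> \<bullet> x) - 1 - \<i> * of_real v) \<le> (2 + norm \<xi> + (norm \<xi>)\<^sup>2) * min 1 ((norm x)\<^sup>2)"
    and "v\<^sup>2 \<le> (norm \<xi>)\<^sup>2 * min 1 ((norm x)\<^sup>2)"
proof -
  define u where "u = \<xi> \<bullet> x"
  have u: "\<bar>u\<bar> \<le> norm \<xi> * norm x" unfolding u_def by (rule Cauchy_Schwarz_ineq2)
  have den: "1 \<le> 1 + (norm x)\<^sup>2" by simp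
  then have absden: "\<bar>1 + (norm x)\<^sup>2\<bar> = 1 + (norm x)\<^sup>2" by simp
  have v: "v = u / (1 + (norm x)\<^sup>2)" unfolding v_def u_def ..
  have vu: "\<bar>v\<bar> \<le> \<bar>u\<bar>" 
    using divide_left_mono[OF den, of "\<bar>u\<bar>"] den unfolding v by (simp add: absden)
  have "norm x \<le> 1 + (norm x)\<^sup>2" using sum_squares_bound[of "norm x" 1] by (simp add: power2_eq_square) (smt (verit) norm_ge_zero)
  then have "\<bar>u\<bar> \<le> norm \<xi> * (1 + (norm x)\<^sup>2)"
    using u mult_left_mono[of "norm x" _ "norm \<xi>"] norm_ge_zero by (meson order_trans)
  then have v1: "\<bar>v\<bar> \<le> norm \<xi>" 
    unfolding v abs_divide absden using den zero_le_power2[of "norm x"]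
    by (subst pos_divide_le_eq) linarith+
  have "\<bar>v\<bar>\<^sup>2 \<le> (norm \<xi>)\<^sup>2" "\<bar>v\<bar>\<^sup>2 \<le> (norm \<xi> * norm x)\<^sup>2"
    by (intro power_mono; use v1 vu u in linarith)+
  then show "v\<^sup>2 \<le> (norm \<xi>)\<^sup>2 * min 1 ((norm x)\<^sup>2)" by (auto simp: min_def power_mult_distrib)
  show "cmod (iexp (\<xi> \<bullet> x) - 1 - \<i> * of_real v) \<le> (2 + norm \<xi> + (norm \<xi>)\<^sup>2) * min 1 ((norm x)\<^sup>2)"
  proof (cases "norm x \<le> 1")
    case True
    then have m: "min 1 ((norm x)\<^sup>2) = (norm x)\<^sup>2" by (simp add: power_le_one min_absorb2)
    have "u - v = u * (norm x)\<^sup>2 / (1 + (norm x)\<^sup>2)"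
    proof -
      have "1 + (norm x)\<^sup>2 \<noteq> 0" using den by linarith
      then show ?thesis unfolding v by (simp add: field_simps)
    qed
    then have "\<bar>u - v\<bar> = \<bar>u\<bar> * (norm x)\<^sup>2 / (1 + (norm x)\<^sup>2)" by (simp add: abs_mult absden)
    also have "\<dots> \<le> \<bar>u\<bar> * (norm x)\<^sup>2 / 1" using den by (intro divide_left_mono) (auto intro: add_pos_nonneg)
    also have "\<dots> \<le> norm \<xi> * (norm x)\<^sup>2"
    proof -
      have "\<bar>u\<bar> \<le> norm \<xi>" using u mult_left_mono[OF True norm_ge_zero[of \<xi>]] by simp
      then show ?thesis by (simp add: mult_right_mono)
    qed
    finally have uv: "\<bar>u - v\<bar> \<le> norm \<xi> * (norm x)\<^sup>2" .
    have "cmod (iexp u - (\<Sum>k\<le>1. (\<i> * u)^k / fact k)) \<le> \<bar>u\<bar>^(Suc 1) / fact (Suc 1)" by (rule iexp_approx1)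
    then have approx: "cmod (iexp u - 1 - \<i> * of_real u) \<le> u\<^sup>2 / 2"
      by (simp add: numeral_2_eq_2[symmetric] diff_diff_eq)
    have usq: "u\<^sup>2 \<le> (norm \<xi>)\<^sup>2 * (norm x)\<^sup>2"
      using power_mono[OF u, of 2] by (simp add: power_mult_distrib)
    have "cmod (\<i> * of_real (u - v)) = \<bar>u - v\<bar>" by (simp add: norm_mult del: of_real_diff)
    moreover have "iexp u - 1 - \<i> * of_real v = (iexp u - 1 - \<i> * of_real u) + \<i> * of_real (u - v)"
      by (simp add: algebra_simps)
    ultimately have "cmod (iexp u - 1 - \<i> * of_real v) \<le> cmod (iexp u - 1 - \<i> * of_real u) + \<bar>u - v\<bar>"
      using norm_triangle_ineq[of "iexp u - 1 - \<i> * of_real u" "\<i> * of_real (u - v)"] by (simp only:)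
    also have "\<dots> \<le> u\<^sup>2 / 2 + norm \<xi> * (norm x)\<^sup>2" by (rule add_mono[OF approx uv])
    also have "\<dots> \<le> (norm \<xi>)\<^sup>2 * (norm x)\<^sup>2 + norm \<xi> * (norm x)\<^sup>2"
      using usq zero_le_power2[of u] by linarith
    also have "\<dots> \<le> (2 + norm \<xi> + (norm \<xi>)\<^sup>2) * (norm x)\<^sup>2" by (simp add: algebra_simps)
    finally show ?thesis unfolding u_def m .
  next
    case False
    then have m: "min 1 ((norm x)\<^sup>2) = 1" by (simp add: min_def one_le_power)
    have "cmod (iexp u - 1 - \<i> * of_real v) \<le> cmod (iexp u) + 1 + \<bar>v\<bar>"
      using norm_triangle_ineq4[of "iexp u - 1" "\<i> * of_real v"] norm_triangle_ineq4[of "iexp u" 1]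
      by (simp add: norm_mult)
    also have "\<dots> \<le> 2 + norm \<xi> + (norm \<xi>)\<^sup>2"
      using v1 zero_le_power2[of "norm \<xi>"] norm_exp_i_times[of u] by linarith
    finally show ?thesis unfolding u_def m by simp
  qed
qed

lemma character_positive_poisson:
  fixes h :: "'b \<Rightarrow> 'a::{real_inner, second_countable_topology}"
  assumes M: "finite_measure M" and h: "h \<in> measurable M borel" and r: "0 \<le> r"
  shows "character_positive (\<lambda>\<xi>. exp (\<integral>y. of_real r * (character (h y) \<xi> - 1) \<partial>M))"
proof -
  interpret finite_measure M by fact
  have "exp (\<integral>y. of_real r * (character (h y) \<xi> - 1) \<partial>M)
      = of_real (exp (- r * measure M (space M))) * exp (of_real r * (\<integral>y. character (h y) \<xi> \<partial>M))" for \<xi>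
    by (simp add: integrable_character[OF M h] scaleR_conv_of_real exp_of_real[symmetric]
        mult_exp_exp algebra_simps)
  then show ?thesis
    using character_positive_mult[OF character_positive_const
        character_positive_exp[OF character_positive_scale[OF character_positive_integral[OF M h] r]],
        of "exp (- r * measure M (space M))"] by simp
qed

text \<open>
  The integrand is approximated by compound Poisson exponents for the finite restrictions of \<open>m\<close> to
  \<open>{|x| > 1/n}\<close>. The compensator \<open>-i v\<close>, with \<open>v = \<langle>\<xi>, x\<rangle> / (1 + |x|\<^sup>2)\<close>, is itself replaced by
  the Poisson exponent \<open>n (e\<^bsup>-i v/n\<^esup> - 1)\<close> of small jumps, so that no vector-valued drift integral
  occurs. Both errors are dominated by a multiple of \<open>min 1 |x|\<^sup>2\<close>.
\<close>

lemma character_positive_levy: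
  fixes m :: "'a::{real_inner, second_countable_topology} measure"
  assumes m: "levy_measure m"
  shows "character_positive (\<lambda>\<xi>. exp (\<integral>x. (iexp (\<xi> \<bullet> x) - 1
           - \<i> * of_real (\<xi> \<bullet> x) / of_real (1 + (norm x)\<^sup>2)) \<partial>m))"
proof -
  have sets_m [measurable_cong]: "sets m = sets borel" using m unfolding levy_measure_def by blast
  have sp: "space m = UNIV" using sets_eq_imp_space_eq[OF sets_m] by simp
  have int_min: "integrable m (\<lambda>x. min 1 ((norm x)\<^sup>2))"
    by (rule integrableI_nonneg) (use m in \<open>auto simp: levy_measure_def\<close>)
  define A :: "nat \<Rightarrow> 'a set" where "A n = {x. 1 / real (Suc n) < norm x}" for n
  have A [measurable]: "A n \<in> sets m" for n unfolding sets_m A_def by measurable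
  have fin: "emeasure m (A n) < \<infinity>" for n
  proof -
    have "integrable m (\<lambda>x. indicator (A n) x :: real)"
    proof (rule Bochner_Integration.integrable_bound[OF integrable_mult_right[OF int_min, of "(real (Suc n))\<^sup>2"]])
      show "AE x in m. norm (indicator (A n) x :: real) \<le> norm ((real (Suc n))\<^sup>2 * min 1 ((norm x)\<^sup>2))"
      proof (rule AE_I2)
        fix x :: 'a
        have "1 \<le> (real (Suc n))\<^sup>2 * min 1 ((norm x)\<^sup>2)" if "x \<in> A n"
        proof -
          have "1 \<le> real (Suc n) * norm x" using that unfolding A_def by (simp add: field_simps)
          then have "1 \<le> (real (Suc n) * norm x)\<^sup>2" by (rule one_le_power)
          moreover have "1 \<le> (real (Suc n))\<^sup>2" by (rule one_le_power) simp
          ultimately show ?thesis unfolding min_def power_mult_distrib by simp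
        qed
        then show "norm (indicator (A n) x :: real) \<le> norm ((real (Suc n))\<^sup>2 * min 1 ((norm x)\<^sup>2))"
          by (auto split: split_indicator)
      qed
    qed simp
    then show ?thesis by (simp add: integrable_indicator_iff sp)
  qed
  define M where "M n = density m (indicator (A n))" for n
  have sM [measurable_cong]: "sets (M n) = sets borel" for n unfolding M_def by (simp add: sets_m)
  have finM: "finite_measure (M n)" for n
    by (rule finite_measureI) (use fin[of n] in \<open>simp add: M_def emeasure_density sp\<close>)
  \<comment> \<open>the small jumps that simulate the compensator\<close>
  define h :: "'a \<Rightarrow> nat \<Rightarrow> 'a" where
    "h x n = (- (1 / (real (Suc n) * (1 + (norm x)\<^sup>2)))) *\<^sub>R x" for x n
  have h [measurable]: "(\<lambda>x. h x n) \<in> borel_measurable borel" for n unfolding h_def by measurable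
  define F where "F n \<xi> x = (character x \<xi> - 1) + of_real (real (Suc n)) * (character (h x n) \<xi> - 1)" for n \<xi> x
  define L where "L \<xi> x = iexp (\<xi> \<bullet> x) - 1 - \<i> * of_real (\<xi> \<bullet> x) / of_real (1 + (norm x)\<^sup>2)" for \<xi> x :: 'a
  have F_meas [measurable]: "F n \<xi> \<in> borel_measurable borel" for n \<xi>
    unfolding F_def character_def by measurable
  have L_meas [measurable]: "L \<xi> \<in> borel_measurable borel" for \<xi>
    unfolding L_def by measurable
  have hF: "cmod (F n \<xi> x - L \<xi> x) \<le> (1 / real (Suc n)) * ((norm \<xi>)\<^sup>2 * min 1 ((norm x)\<^sup>2))" for n \<xi> x
  proof -
    define v where "v = (\<xi> \<bullet> x) / (1 + (norm x)\<^sup>2)"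
    define w where "w = - (v / real (Suc n))"
    have hw: "character (h x n) \<xi> = iexp w"
      unfolding character_def h_def w_def v_def by (simp add: field_simps)
    have "F n \<xi> x - L \<xi> x = of_real (real (Suc n)) * (iexp w - 1) + \<i> * of_real v"
      unfolding F_def L_def hw v_def by (simp add: character_def)
    also have "of_real v = - (of_real (real (Suc n)) * of_real w :: complex)"
      unfolding w_def of_real_mult[symmetric] by simp
    finally have "F n \<xi> x - L \<xi> x = of_real (real (Suc n)) * (iexp w - 1 - \<i> * of_real w)"
      by (simp add: algebra_simps)
    moreover have "cmod (iexp w - (\<Sum>k\<le>1. (\<i> * w)^k / fact k)) \<le> \<bar>w\<bar>^(Suc 1) / fact (Suc 1)" by (rule iexp_approx1)
    then have "cmod (iexp w - 1 - \<i> * of_real w) \<le> w\<^sup>2 / 2"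
      by (simp add: numeral_2_eq_2[symmetric] diff_diff_eq)
    ultimately have "cmod (F n \<xi> x - L \<xi> x) \<le> real (Suc n) * (w\<^sup>2 / 2)"
      by (simp only: norm_mult norm_of_real abs_of_nat) (intro mult_left_mono; simp)
    also have "\<dots> = (1 / real (Suc n)) * (v\<^sup>2 / 2)"
      unfolding w_def power2_eq_square by simp
    also have "\<dots> \<le> (1 / real (Suc n)) * ((norm \<xi>)\<^sup>2 * min 1 ((norm x)\<^sup>2))"
      using levy_integrand_bound(2)[of \<xi> x] unfolding v_def
      by (intro mult_left_mono) (simp_all, smt (verit) zero_le_power2)
    finally show ?thesis .
  qed
  show ?thesis
  proof (rule character_positive_limit)
    have eq: "exp (\<integral>x. F n \<xi> x \<partial>M n) =
        exp (\<integral>x. of_real 1 * (character x \<xi> - 1) \<partial>M n) *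
        exp (\<integral>x. of_real (real (Suc n)) * (character (h x n) \<xi> - 1) \<partial>M n)" for n \<xi>
    proof -
      interpret finite_measure "M n" by (rule finM)
      have "integrable (M n) (\<lambda>x. character x \<xi>)" "integrable (M n) (\<lambda>x. character (h x n) \<xi>)"
        by (intro integrable_character finM; measurable)+
      then show ?thesis unfolding F_def
        by (subst Bochner_Integration.integral_add) (simp_all add: exp_add)
    qed
    show "character_positive (\<lambda>\<xi>. exp (\<integral>x. F n \<xi> x \<partial>M n))" for n
      unfolding eq by (intro character_positive_mult character_positive_poisson finM; simp)
    fix \<xi>
    have "(\<lambda>n. \<integral>x. indicator (A n) x *\<^sub>R F n \<xi> x \<partial>m) \<longlonglongrightarrow> (\<integral>x. L \<xi> x \<partial>m)"
    proof (rule integral_dominated_convergence)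
      show "integrable m (\<lambda>x. (2 + norm \<xi> + 2 * (norm \<xi>)\<^sup>2) * min 1 ((norm x)\<^sup>2))"
        by (intro integrable_mult_right int_min)
      have lim: "(\<lambda>n. indicator (A n) x *\<^sub>R F n \<xi> x) \<longlonglongrightarrow> L \<xi> x" if "x \<noteq> 0" for x
      proof -
        have "(\<lambda>n. 1 / real (Suc n)) \<longlonglongrightarrow> 0"
          using LIMSEQ_inverse_real_of_nat by (simp add: inverse_eq_divide)
        then have "\<forall>\<^sub>F n in sequentially. 1 / real (Suc n) < norm x"
          by (rule order_tendstoD) (use that in simp)
        then have "\<forall>\<^sub>F n in sequentially. indicator (A n) x *\<^sub>R F n \<xi> x = F n \<xi> x"
          by eventually_elim (simp add: A_def)
        moreover have "(\<lambda>n. F n \<xi> x - L \<xi> x) \<longlonglongrightarrow> 0"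
        proof (rule Lim_null_comparison)
          show "\<forall>\<^sub>F n in sequentially. norm (F n \<xi> x - L \<xi> x)
              \<le> (1 / real (Suc n)) * ((norm \<xi>)\<^sup>2 * min 1 ((norm x)\<^sup>2))"
            using hF by simp
          show "(\<lambda>n. (1 / real (Suc n)) * ((norm \<xi>)\<^sup>2 * min 1 ((norm x)\<^sup>2))) \<longlonglongrightarrow> 0"
            by (rule tendsto_mult_left_zero) fact
        qed
        ultimately show ?thesis by (simp add: LIM_zero_iff tendsto_cong)
      qed
      show "AE x in m. (\<lambda>n. indicator (A n) x *\<^sub>R F n \<xi> x) \<longlonglongrightarrow> L \<xi> x"
      proof (rule AE_I2)
        fix x :: 'a
        show "(\<lambda>n. indicator (A n) x *\<^sub>R F n \<xi> x) \<longlonglongrightarrow> L \<xi> x"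
        proof (cases "x = 0")
          case True
          then show ?thesis by (simp add: L_def A_def)
        qed (rule lim)
      qed
      show "AE x in m. norm (indicator (A n) x *\<^sub>R F n \<xi> x)
          \<le> (2 + norm \<xi> + 2 * (norm \<xi>)\<^sup>2) * min 1 ((norm x)\<^sup>2)" for n
      proof (rule AE_I2)
        fix x :: 'a
        let ?a = "(norm \<xi>)\<^sup>2 * min 1 ((norm x)\<^sup>2)"
        have "(1 / real (Suc n)) * ?a \<le> 1 * ?a" by (intro mult_right_mono) auto
        then have "cmod (F n \<xi> x - L \<xi> x) \<le> ?a" using hF[of n \<xi> x] by linarith
        moreover have "cmod (L \<xi> x) \<le> (2 + norm \<xi> + (norm \<xi>)\<^sup>2) * min 1 ((norm x)\<^sup>2)"
          using levy_integrand_bound(1)[of \<xi> x] unfolding L_def by simp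
        moreover have "cmod (F n \<xi> x) \<le> cmod (L \<xi> x) + cmod (F n \<xi> x - L \<xi> x)"
          using norm_triangle_sub by blast
        ultimately have "cmod (F n \<xi> x) \<le> (2 + norm \<xi> + 2 * (norm \<xi>)\<^sup>2) * min 1 ((norm x)\<^sup>2)"
          by (simp add: algebra_simps)
        then show "norm (indicator (A n) x *\<^sub>R F n \<xi> x)
            \<le> (2 + norm \<xi> + 2 * (norm \<xi>)\<^sup>2) * min 1 ((norm x)\<^sup>2)"
          by (auto split: split_indicator)
      qed
    qed measurable
    moreover have "(\<integral>x. indicator (A n) x *\<^sub>R F n \<xi> x \<partial>m) = (\<integral>x. F n \<xi> x \<partial>M n)" for n
      unfolding M_def by (subst integral_density[symmetric]) (auto simp: ennreal_indicator)
    ultimately show "(\<lambda>n. exp (\<integral>x. F n \<xi> x \<partial>M n)) \<longlonglongrightarrow> exp (\<integral>x. (iexp (\<xi> \<bullet> x) - 1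
           - \<i> * of_real (\<xi> \<bullet> x) / of_real (1 + (norm x)\<^sup>2)) \<partial>m)"
      unfolding L_def by (intro tendsto_exp) simp
  qed
qed

section \<open>Splitting off one Gaussian direction\<close>

text \<open>
  Informally, \<open>\<mu>\<close> is the convolution of the law of \<open>\<sigma> R\<^sup>1\<^sup>/\<^sup>2 e\<close>, for a standard normal \<open>\<sigma>\<close>, with
  the measure \<open>[a, R - k \<otimes> k, m]\<close>, where \<open>k = R\<^sup>1\<^sup>/\<^sup>2 e\<close>; \<open>\<phi>\<close> is the characteristic function of the latter.
\<close>

lemma character_positive_levy_quotient:
  fixes \<mu> m :: "'a::{real_inner, complete_space, second_countable_topology} measure"
  assumes \<mu>: "has_levy_triplet \<mu> a R m" and e: "e = 0 \<or> norm e = 1"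
  shows "\<exists>\<phi>. character_positive \<phi> \<and>
    (\<forall>\<xi>. (\<integral>x. character x \<xi> \<partial>\<mu>) = \<phi> \<xi> * of_real (exp (- (\<xi> \<bullet> op_sqrt R e)\<^sup>2 / 2)))"
proof (intro exI conjI allI)
  define S where "S = op_sqrt R"
  have R: "nonneg_symmetric R" and m: "levy_measure m"
    using \<mu> unfolding has_levy_triplet_def by auto
  have sym: "S x \<bullet> y = x \<bullet> S y" for x y
    using op_sqrt_properties(1)[OF R] unfolding S_def nonneg_symmetric_def by blast
  have RS: "R \<xi> = S (S \<xi>)" for \<xi>
    using op_sqrt_properties(2)[OF R] unfolding S_def by (metis blinfun_apply_blinfun_compose)
  let ?G = "\<lambda>\<xi>. complex_of_real (exp (- ((norm (S \<xi>))\<^sup>2 - (\<xi> \<bullet> S e)\<^sup>2) / 2))"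
  let ?J = "\<lambda>\<xi>. \<integral>x. (iexp (\<xi> \<bullet> x) - 1 - \<i> * of_real (\<xi> \<bullet> x) / of_real (1 + (norm x)\<^sup>2)) \<partial>m"
  show "character_positive (\<lambda>\<xi>. character a \<xi> * (?G \<xi> * exp (?J \<xi>)))"
    by (intro character_positive_mult character_positive_character
        character_positive_gauss_remainder character_positive_levy sym e m)
  fix \<xi>
  have "(\<integral>x. character x \<xi> \<partial>\<mu>) = exp (- levy_symbol a R m \<xi>)"
  proof -
    have "(\<integral>x. iexp (x \<bullet> \<xi>) \<partial>\<mu>) = exp (- levy_symbol a R m \<xi>)"
      using \<mu> unfolding has_levy_triplet_def by blast
    then show ?thesis unfolding character_def by (simp only: inner_commute)
  qed
  also have "- levy_symbol a R m \<xi> = \<i> * of_real (\<xi> \<bullet> a) + of_real (- ((norm (S \<xi>))\<^sup>2 - (\<xi> \<bullet> S e)\<^sup>2) / 2)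
      + ?J \<xi> + of_real (- (\<xi> \<bullet> S e)\<^sup>2 / 2)"
  proof -
    have "R \<xi> \<bullet> \<xi> = (norm (S \<xi>))\<^sup>2"
      using sym[of "S \<xi>" \<xi>] by (simp only: RS power2_norm_eq_inner)
    moreover have "a \<bullet> \<xi> = \<xi> \<bullet> a" by (rule inner_commute)
    ultimately show ?thesis
      unfolding levy_symbol_def by (simp add: diff_divide_distrib)
  qed
  also have "exp \<dots> = character a \<xi> * (?G \<xi> * exp (?J \<xi>)) * of_real (exp (- (\<xi> \<bullet> op_sqrt R e)\<^sup>2 / 2))"
    unfolding exp_of_real[symmetric] character_def S_def exp_add by (simp add: mult.assoc)
  finally show "(\<integral>x. character x \<xi> \<partial>\<mu>) = \<dots>" .
qed

section \<open>Shifting a standard normal variable\<close>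

lemma normal_density_shift_exp:
  "normal_density b 1 x = exp (b * x - b\<^sup>2 / 2) * std_normal_density x"
  unfolding normal_density_def
  by (simp add: mult_exp_exp power2_eq_square field_simps)

lemma has_bochner_integral_exp_gauss:
  "has_bochner_integral std_normal_distribution (\<lambda>\<sigma>. exp (b * \<sigma>)) (exp (b\<^sup>2 / 2))"
proof -
  have "has_bochner_integral lborel (normal_density b 1) 1"
    using integrable_normal_density[of 1 b] integral_normal_density[of 1 b]
    by (simp add: has_bochner_integral_iff)
  then have "has_bochner_integral lborel (\<lambda>x. exp (b\<^sup>2 / 2) * normal_density b 1 x) (exp (b\<^sup>2 / 2) * 1)"
    by (rule has_bochner_integral_mult_right)
  moreover have "exp (b\<^sup>2 / 2) * normal_density b 1 x = std_normal_density x *\<^sub>R exp (b * x)" for x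
  proof -
    have "exp (b\<^sup>2 / 2) * exp (b * x - b\<^sup>2 / 2) = exp (b * x)" by (simp add: mult_exp_exp)
    then show ?thesis by (simp only: normal_density_shift_exp[of b] real_scaleR_def) (simp only: mult_ac)
  qed
  ultimately have "has_bochner_integral lborel (\<lambda>x. std_normal_density x *\<^sub>R exp (b * x)) (exp (b\<^sup>2 / 2))"
    by (simp only: mult_1_right)
  then show ?thesis
    by (intro has_bochner_integral_density) auto
qed

lemma integral_std_normal_shift:
  fixes h :: "real \<Rightarrow> real"
  assumes [measurable]: "h \<in> borel_measurable borel"
  shows "(\<integral>\<sigma>. h (\<sigma> + c) \<partial>std_normal_distribution)
       = (\<integral>\<sigma>. exp (c * \<sigma> - c\<^sup>2 / 2) * h \<sigma> \<partial>std_normal_distribution)"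
proof -
  have "(\<integral>\<sigma>. h (\<sigma> + c) \<partial>std_normal_distribution) = (\<integral>x. std_normal_density x * h (x + c) \<partial>lborel)"
    by (subst integral_density) auto
  also have "\<dots> = (\<integral>x. std_normal_density (- c + x) * h x \<partial>lborel)"
    by (subst lborel_integral_real_affine[of 1 _ "-c"]) (auto simp: add.commute)
  also have "\<dots> = (\<integral>x. std_normal_density x * (exp (c * x - c\<^sup>2 / 2) * h x) \<partial>lborel)"
  proof -
    have "std_normal_density (- c + x) = normal_density c 1 x" for x
      unfolding normal_density_def by simp
    then show ?thesis by (simp only: normal_density_shift_exp[of c] mult_ac)
  qed
  also have "\<dots> = (\<integral>\<sigma>. exp (c * \<sigma> - c\<^sup>2 / 2) * h \<sigma> \<partial>std_normal_distribution)"
    by (subst integral_density) auto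
  finally show ?thesis .
qed

text \<open>
  Young's inequality with a free parameter, which is optimised at the very end. Until then every
  estimate is linear in the integrals involved, so it survives positive functionals and
  \<open>L\<^sup>1\<close>-approximation.
\<close>

lemma weighted_Young:
  fixes u \<rho> s \<alpha> \<beta> :: real
  assumes \<alpha>: "1 < \<alpha>" and \<beta>: "\<beta> = \<alpha> / (\<alpha> - 1)" and s: "0 < s" and \<rho>: "0 \<le> \<rho>"
  shows "\<rho> * u \<le> s / \<alpha> * (max 0 u) powr \<alpha> + s powr (1 - \<beta>) / \<beta> * \<rho> powr \<beta>"
proof -
  have \<beta>1: "1 < \<beta>" using \<alpha> unfolding \<beta> by (simp add: field_simps)
  have conj: "1 / \<alpha> + 1 / \<beta> = 1" using \<alpha> unfolding \<beta> by (simp add: field_simps)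
  have "\<rho> * u \<le> (s powr (1/\<alpha>) * max 0 u) * (s powr (-1/\<alpha>) * \<rho>)"
  proof -
    have "s powr (1/\<alpha>) * s powr (-1/\<alpha>) = 1"
      using s by (simp add: powr_add[symmetric])
    moreover have "(s powr (1/\<alpha>) * max 0 u) * (s powr (-1/\<alpha>) * \<rho>)
        = (s powr (1/\<alpha>) * s powr (-1/\<alpha>)) * (\<rho> * max 0 u)"
      by (simp only: mult_ac)
    ultimately have "(s powr (1/\<alpha>) * max 0 u) * (s powr (-1/\<alpha>) * \<rho>) = \<rho> * max 0 u"
      by (simp only: mult_1)
    moreover have "\<rho> * u \<le> \<rho> * max 0 u" by (rule mult_left_mono[OF _ \<rho>]) simp
    ultimately show ?thesis by (simp only:)
  qed
  also have "\<dots> \<le> (s powr (1/\<alpha>) * max 0 u) powr \<alpha> / \<alpha> + (s powr (-1/\<alpha>) * \<rho>) powr \<beta> / \<beta>"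
    by (rule Youngs_inequality[OF \<alpha> \<beta>1 conj]) (use \<rho> in auto)
  also have "(s powr (1/\<alpha>) * max 0 u) powr \<alpha> = s * (max 0 u) powr \<alpha>"
    using \<alpha> s by (simp add: powr_mult powr_powr)
  also have "(s powr (-1/\<alpha>) * \<rho>) powr \<beta> = s powr (1 - \<beta>) * \<rho> powr \<beta>"
  proof -
    have "(-1/\<alpha>) * \<beta> = 1 - \<beta>" using \<alpha> unfolding \<beta> by (simp add: field_simps)
    then show ?thesis using s \<rho> by (simp add: powr_mult powr_powr)
  qed
  finally show ?thesis by simp
qed

text \<open>
  One-dimensional Cameron-Martin formula followed by Young's inequality; the last term is the
  \<open>\<beta>\<close>-th moment of the density. A general \<open>q\<close> above the power of \<open>h\<close> is allowed because the power of
  a trigonometric polynomial need not be one.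
\<close>

lemma gauss_shift_Young:
  fixes h q :: "real \<Rightarrow> real"
  assumes \<alpha>: "1 < \<alpha>" and \<beta>: "\<beta> = \<alpha> / (\<alpha> - 1)" and s: "0 < s"
    and h [measurable]: "h \<in> borel_measurable borel" "\<And>\<sigma>. \<bar>h \<sigma>\<bar> \<le> K"
    and q [measurable]: "q \<in> borel_measurable borel" "\<And>\<sigma>. \<bar>q \<sigma>\<bar> \<le> K"
    and hq: "\<And>\<sigma>. s / \<alpha> * (max 0 (h \<sigma>)) powr \<alpha> \<le> q \<sigma>"
  shows "(\<integral>\<sigma>. h (\<sigma> + c) \<partial>std_normal_distribution)
     \<le> (\<integral>\<sigma>. q \<sigma> \<partial>std_normal_distribution) + s powr (1 - \<beta>) / \<beta> * exp ((\<beta>\<^sup>2 - \<beta>) * c\<^sup>2 / 2)"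
proof -
  interpret G: real_distribution std_normal_distribution by (rule real_dist_normal_dist)
  have \<beta>0: "0 < \<beta>" using \<alpha> unfolding \<beta> by simp
  have pw: "exp (c * \<sigma> - c\<^sup>2 / 2) powr \<beta> = exp (- \<beta> * c\<^sup>2 / 2) * exp (\<beta> * c * \<sigma>)" for \<sigma>
    by (simp add: powr_def mult_exp_exp algebra_simps)
  have ib: "has_bochner_integral std_normal_distribution
      (\<lambda>\<sigma>. exp (- \<beta> * c\<^sup>2 / 2) * exp (\<beta> * c * \<sigma>)) (exp (- \<beta> * c\<^sup>2 / 2) * exp ((\<beta> * c)\<^sup>2 / 2))"
    by (intro has_bochner_integral_mult_right has_bochner_integral_exp_gauss)
  then have iw: "integrable std_normal_distribution (\<lambda>\<sigma>. exp (c * \<sigma> - c\<^sup>2 / 2) powr \<beta>)"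
    and Iw: "(\<integral>\<sigma>. exp (c * \<sigma> - c\<^sup>2 / 2) powr \<beta> \<partial>std_normal_distribution)
        = exp ((\<beta>\<^sup>2 - \<beta>) * c\<^sup>2 / 2)"
    unfolding pw has_bochner_integral_iff
    by (auto simp: mult_exp_exp power_mult_distrib field_simps)
  have ie: "integrable std_normal_distribution (\<lambda>\<sigma>. exp (c * \<sigma> - c\<^sup>2 / 2))"
  proof -
    have "has_bochner_integral std_normal_distribution
        (\<lambda>\<sigma>. exp (- c\<^sup>2 / 2) * exp (c * \<sigma>)) (exp (- c\<^sup>2 / 2) * exp (c\<^sup>2 / 2))"
      by (intro has_bochner_integral_mult_right has_bochner_integral_exp_gauss)
    then show ?thesis by (auto simp: has_bochner_integral_iff mult_exp_exp)
  qed
  have iq: "integrable std_normal_distribution q"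
    by (rule G.integrable_const_bound[where B = K]) (use q in auto)
  have ieh: "integrable std_normal_distribution (\<lambda>\<sigma>. exp (c * \<sigma> - c\<^sup>2 / 2) * h \<sigma>)"
  proof (rule Bochner_Integration.integrable_bound[OF integrable_mult_left[OF ie, of K]])
    show "AE \<sigma> in std_normal_distribution. norm (exp (c * \<sigma> - c\<^sup>2 / 2) * h \<sigma>)
        \<le> norm (exp (c * \<sigma> - c\<^sup>2 / 2) * K)"
      using h(2) by (intro AE_I2) (auto simp: abs_mult intro!: mult_left_mono order_trans[OF _ abs_ge_self])
  qed simp
  have "(\<integral>\<sigma>. h (\<sigma> + c) \<partial>std_normal_distribution)
      = (\<integral>\<sigma>. exp (c * \<sigma> - c\<^sup>2 / 2) * h \<sigma> \<partial>std_normal_distribution)"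
    by (rule integral_std_normal_shift) simp
  also have "\<dots> \<le> (\<integral>\<sigma>. q \<sigma> + s powr (1 - \<beta>) / \<beta> * exp (c * \<sigma> - c\<^sup>2 / 2) powr \<beta> \<partial>std_normal_distribution)"
  proof (rule integral_mono[OF ieh])
    show "integrable std_normal_distribution
        (\<lambda>\<sigma>. q \<sigma> + s powr (1 - \<beta>) / \<beta> * exp (c * \<sigma> - c\<^sup>2 / 2) powr \<beta>)"
      by (intro Bochner_Integration.integrable_add integrable_mult_right iq iw)
    fix \<sigma>
    show "exp (c * \<sigma> - c\<^sup>2 / 2) * h \<sigma> \<le> q \<sigma> + s powr (1 - \<beta>) / \<beta> * exp (c * \<sigma> - c\<^sup>2 / 2) powr \<beta>"
      using weighted_Young[OF \<alpha> \<beta> s, of "exp (c * \<sigma> - c\<^sup>2 / 2)" "h \<sigma>"] hq[of \<sigma>] by simp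
  qed
  also have "\<dots> = (\<integral>\<sigma>. q \<sigma> \<partial>std_normal_distribution) + s powr (1 - \<beta>) / \<beta> * exp ((\<beta>\<^sup>2 - \<beta>) * c\<^sup>2 / 2)"
    by (subst Bochner_Integration.integral_add[OF iq integrable_mult_right[OF iw]])
      (simp only: integral_mult_right_zero Iw)
  finally show ?thesis .
qed

section \<open>Trigonometric polynomials\<close>

definition complex_trig_polys :: "('a::real_inner \<Rightarrow> complex) set" where
  "complex_trig_polys = range (\<lambda>ps x. pairing ps (character x))"

definition trig_polys :: "('a::real_inner \<Rightarrow> real) set" where
  "trig_polys = range (\<lambda>ps x. Re (pairing ps (character x)))"

lemma complex_trig_polysI: "(\<And>x. f x = pairing ps (character x)) \<Longrightarrow> f \<in> complex_trig_polys"
  unfolding complex_trig_polys_def by blast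

lemma complex_trig_polys_add:
  assumes "f \<in> complex_trig_polys" "g \<in> complex_trig_polys"
  shows "(\<lambda>x. f x + g x) \<in> complex_trig_polys"
proof -
  obtain ps qs where "f = (\<lambda>x. pairing ps (character x))" "g = (\<lambda>x. pairing qs (character x))"
    using assms unfolding complex_trig_polys_def by blast
  then show ?thesis by (intro complex_trig_polysI[of _ "ps @ qs"]) simp
qed

lemma complex_trig_polys_monomial_mult:
  assumes "f \<in> complex_trig_polys"
  shows "(\<lambda>x. c * character x \<xi> * f x) \<in> complex_trig_polys"
proof -
  obtain ps where f: "f = (\<lambda>x. pairing ps (character x))"
    using assms unfolding complex_trig_polys_def by blast
  have "c * character x \<xi> * pairing ps (character x)
      = pairing (map (\<lambda>(d, \<eta>). (c * d, \<xi> + \<eta>)) ps) (character x)" for x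
  proof (induction ps)
    case (Cons p ps)
    have "character x (\<xi> + snd p) = character x \<xi> * character x (snd p)"
      by (simp add: character_def inner_add_left exp_add distrib_left)
    then show ?case using Cons by (cases p) (simp add: algebra_simps)
  qed simp
  then show ?thesis unfolding f by (rule complex_trig_polysI)
qed

text \<open>
  Frequencies add, so products of trigonometric polynomials are again trigonometric polynomials.
\<close>

lemma complex_trig_polys_mult:
  assumes "f \<in> complex_trig_polys" and g: "g \<in> complex_trig_polys"
  shows "(\<lambda>x. f x * g x) \<in> complex_trig_polys"
proof -
  obtain ps where f: "f = (\<lambda>x. pairing ps (character x))"
    using assms unfolding complex_trig_polys_def by blast
  show ?thesis unfolding f
  proof (induction ps)
    case Nil
    show ?case by (rule complex_trig_polysI[of _ "[]"]) simp
  next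
    case (Cons p ps)
    then show ?case
      using complex_trig_polys_add[OF complex_trig_polys_monomial_mult[OF g, of "fst p" "snd p"]]
      by (cases p) (simp add: distrib_right)
  qed
qed

lemma complex_trig_polys_cnj:
  assumes "f \<in> complex_trig_polys"
  shows "(\<lambda>x. cnj (f x)) \<in> complex_trig_polys"
proof -
  obtain ps where f: "f = (\<lambda>x. pairing ps (character x))"
    using assms unfolding complex_trig_polys_def by blast
  have "cnj (pairing ps (character x)) = pairing (map (\<lambda>(c, \<xi>). (cnj c, - \<xi>)) ps) (character x)" for x
    by (induction ps) (auto simp: character_def exp_cnj)
  then show ?thesis unfolding f by (rule complex_trig_polysI)
qed

text \<open>
  The real part is half the sum with the conjugate; hence real trigonometric polynomials inherit the
  algebra structure of the complex ones.
\<close>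

lemma trig_polys_iff: "p \<in> trig_polys \<longleftrightarrow> (\<lambda>x. complex_of_real (p x)) \<in> complex_trig_polys"
proof
  assume "p \<in> trig_polys"
  then obtain ps where p: "p = (\<lambda>x. Re (pairing ps (character x)))"
    unfolding trig_polys_def by blast
  let ?f = "\<lambda>x. pairing ps (character x)"
  have f: "?f \<in> complex_trig_polys" by (rule complex_trig_polysI) simp
  have half: "(\<lambda>x. 1/2) \<in> complex_trig_polys"
    by (rule complex_trig_polysI[of _ "[(1/2, 0)]"]) (simp add: character_def)
  have "(\<lambda>x. 1/2 * (?f x + cnj (?f x))) \<in> complex_trig_polys"
    by (intro complex_trig_polys_mult complex_trig_polys_add complex_trig_polys_cnj f half)
  then show "(\<lambda>x. complex_of_real (p x)) \<in> complex_trig_polys"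
    unfolding p complex_add_cnj by simp
next
  assume "(\<lambda>x. complex_of_real (p x)) \<in> complex_trig_polys"
  then obtain ps where "(\<lambda>x. complex_of_real (p x)) = (\<lambda>x. pairing ps (character x))"
    unfolding complex_trig_polys_def by blast
  from fun_cong[OF this] have "p x = Re (pairing ps (character x))" for x by (metis Re_complex_of_real)
  then show "p \<in> trig_polys" unfolding trig_polys_def by blast
qed

lemma trig_polys_const: "(\<lambda>x. c) \<in> trig_polys"
  unfolding trig_polys_iff
  by (rule complex_trig_polysI[of _ "[(of_real c, 0)]"]) (simp add: character_def)

lemma trig_polys_add: "p \<in> trig_polys \<Longrightarrow> q \<in> trig_polys \<Longrightarrow> (\<lambda>x. p x + q x) \<in> trig_polys"
  using complex_trig_polys_add unfolding trig_polys_iff by fastforce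

lemma trig_polys_mult: "p \<in> trig_polys \<Longrightarrow> q \<in> trig_polys \<Longrightarrow> (\<lambda>x. p x * q x) \<in> trig_polys"
  using complex_trig_polys_mult unfolding trig_polys_iff by fastforce

lemma trig_polys_polynomial:
  assumes "real_polynomial_function q" "p \<in> trig_polys"
  shows "(\<lambda>x. q (p x)) \<in> trig_polys"
  using assms(1)
proof induction
  case (linear f)
  have "f t = t * f 1" for t
    using linear.hyps[THEN bounded_linear.linear, THEN linear_cmul, of t 1] by simp
  then have "(\<lambda>x. f (p x)) = (\<lambda>x. p x * f 1)" by blast
  then show ?case using trig_polys_mult[OF assms(2) trig_polys_const] by simp
qed (auto intro: trig_polys_const trig_polys_add trig_polys_mult)

lemma trig_polys_bounded:
  assumes "p \<in> trig_polys"
  shows "\<exists>K\<ge>0. \<forall>x. \<bar>p x\<bar> \<le> K"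
proof -
  obtain ps where p: "p = (\<lambda>x. Re (pairing ps (character x)))"
    using assms unfolding trig_polys_def by blast
  have "\<exists>K. \<forall>x. cmod (pairing ps (character x)) \<le> K"
  proof (induction ps)
    case (Cons a ps)
    then obtain K where K: "\<forall>x. cmod (pairing ps (character x)) \<le> K" by blast
    have "cmod (pairing (a # ps) (character x)) \<le> cmod (fst a) + K" for x
      using norm_triangle_ineq[of "fst a * character x (snd a)" "pairing ps (character x)"] K[rule_format, of x]
      by (cases a) (simp add: norm_mult)
    then show ?case by blast
  qed auto
  then obtain K where "\<forall>x. cmod (pairing ps (character x)) \<le> K" by blast
  then have "\<forall>x. \<bar>p x\<bar> \<le> K" unfolding p using abs_Re_le_cmod order_trans by blast
  moreover from this have "0 \<le> K" using abs_ge_zero order_trans by blast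
  ultimately show ?thesis by blast
qed

lemma trig_polys_measurable:
  fixes p :: "'a::{real_inner, second_countable_topology} \<Rightarrow> real"
  assumes "p \<in> trig_polys"
  shows "p \<in> borel_measurable borel"
proof -
  obtain ps where p: "p = (\<lambda>x. Re (pairing ps (character x)))"
    using assms unfolding trig_polys_def by blast
  have "(\<lambda>x. pairing ps (character x)) \<in> borel_measurable borel"
    by (induction ps) (auto simp: character_def)
  then show ?thesis unfolding p by measurable
qed

text \<open>
  Weierstrass approximation of \<open>\<psi>\<close> on the bounded range of \<open>p\<close>.
\<close>

lemma trig_polys_approximation:
  fixes \<psi> :: "real \<Rightarrow> real"
  assumes p: "p \<in> trig_polys" and \<psi>: "continuous_on UNIV \<psi>" and "0 < \<epsilon>"
  shows "\<exists>q\<in>trig_polys. \<forall>x. \<bar>\<psi> (p x) - q x\<bar> \<le> \<epsilon>"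
proof -
  obtain K where K: "\<And>x. \<bar>p x\<bar> \<le> K" using trig_polys_bounded[OF p] by blast
  obtain g where g: "real_polynomial_function g" "\<And>t. t \<in> {-K..K} \<Longrightarrow> \<bar>\<psi> t - g t\<bar> < \<epsilon>"
    using Stone_Weierstrass_real_polynomial_function[of "{-K..K}" \<psi> \<epsilon>]
      continuous_on_subset[OF \<psi>] \<open>0 < \<epsilon>\<close> by (metis compact_Icc subset_UNIV)
  have "\<bar>\<psi> (p x) - g (p x)\<bar> \<le> \<epsilon>" for x
    using g(2)[of "p x"] K[of x] by (simp add: abs_le_iff less_imp_le)
  then show ?thesis
    by (intro bexI[of _ "\<lambda>x. g (p x)"] allI trig_polys_polynomial[OF g(1) p])
qed

text \<open>
  For every \<open>x\<close> the one-dimensional inequality along the line \<open>x + \<real> k\<close> says that a certain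
  trigonometric polynomial in \<open>x\<close> is non-negative: integrating out the normal variable merely
  multiplies the coefficients by its characteristic function. Pairing this polynomial with \<open>\<phi>\<close>, as if
  integrating \<open>x\<close> against the complementary factor of \<open>\<mu>\<close>, restores the characteristic function
  of \<open>\<mu>\<close>.
\<close>

lemma shift_inequality_trig_polys:
  fixes \<mu> :: "'a::{real_inner, second_countable_topology} measure"
  assumes \<mu>: "borel_prob \<mu>" and \<phi>: "character_positive \<phi>"
    and factor: "\<And>\<xi>. (\<integral>x. character x \<xi> \<partial>\<mu>) = \<phi> \<xi> * of_real (exp (- (\<xi> \<bullet> k)\<^sup>2 / 2))"
    and \<alpha>: "1 < \<alpha>" and \<beta>: "\<beta> = \<alpha> / (\<alpha> - 1)" and s: "0 < s"
    and p: "p \<in> trig_polys" and q: "q \<in> trig_polys"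
    and pq: "\<And>x. s / \<alpha> * (max 0 (p x)) powr \<alpha> \<le> q x"
  shows "(\<integral>w. p (w + c *\<^sub>R k) \<partial>\<mu>)
       \<le> (\<integral>w. q w \<partial>\<mu>) + s powr (1 - \<beta>) / \<beta> * exp ((\<beta>\<^sup>2 - \<beta>) * c\<^sup>2 / 2)"
proof -
  interpret \<mu>: prob_space \<mu> using \<mu> unfolding borel_prob_def by blast
  have [measurable_cong]: "sets \<mu> = sets borel" using \<mu> unfolding borel_prob_def by blast
  interpret G: real_distribution std_normal_distribution by (rule real_dist_normal_dist)
  define C where "C = s powr (1 - \<beta>) / \<beta> * exp ((\<beta>\<^sup>2 - \<beta>) * c\<^sup>2 / 2)"
  define g where "g \<xi> = complex_of_real (exp (- (\<xi> \<bullet> k)\<^sup>2 / 2))" for \<xi>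
  obtain ps where ps: "p = (\<lambda>x. Re (pairing ps (character x)))"
    using p unfolding trig_polys_def by blast
  obtain qs where qs: "q = (\<lambda>x. Re (pairing qs (character x)))"
    using q unfolding trig_polys_def by blast
  obtain K1 K2 where K1: "\<And>x. \<bar>p x\<bar> \<le> K1" and K2: "\<And>x. \<bar>q x\<bar> \<le> K2"
    using trig_polys_bounded p q by meson
  have smooth: "(\<integral>\<sigma>. character (x + (\<sigma> + b) *\<^sub>R k) \<xi> \<partial>std_normal_distribution)
      = character (b *\<^sub>R k) \<xi> * g \<xi> * character x \<xi>" for x b \<xi>
  proof -
    have "(\<integral>\<sigma>. character (x + (\<sigma> + b) *\<^sub>R k) \<xi> \<partial>std_normal_distribution)
        = (\<integral>\<sigma>. (character x \<xi> * character (b *\<^sub>R k) \<xi>) * character (\<sigma> *\<^sub>R k) \<xi> \<partial>std_normal_distribution)"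
      by (simp add: scaleR_left_distrib character_add mult_ac)
    also have "\<dots> = (character x \<xi> * character (b *\<^sub>R k) \<xi>) * g \<xi>"
      by (subst integral_mult_right_zero) (simp only: integral_character_std_normal g_def)
    finally show ?thesis by (simp only: mult_ac)
  qed
  \<comment> \<open>the difference of the two smoothed polynomials plus the constant \<open>C\<close>\<close>
  let ?L = "map (\<lambda>(d, \<eta>). (d * g \<eta>, \<eta>)) qs @ [(of_real C, 0)]
      @ map (\<lambda>(d, \<xi>). (d * (- (character (c *\<^sub>R k) \<xi> * g \<xi>)), \<xi>)) ps"
  have L: "pairing ?L \<eta> = pairing qs (\<lambda>\<xi>. g \<xi> * \<eta> \<xi>) + of_real C * \<eta> 0
      - pairing ps (\<lambda>\<xi>. character (c *\<^sub>R k) \<xi> * g \<xi> * \<eta> \<xi>)" for \<eta>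
    using pairing_scale[of ps "- 1" "\<lambda>\<xi>. character (c *\<^sub>R k) \<xi> * g \<xi> * \<eta> \<xi>"]
    by (simp only: pairing_simps pairing_modulate) simp
  have "0 \<le> Re (pairing ?L (character x))" for x
  proof -
    have "(\<integral>\<sigma>. p (x + (\<sigma> + c) *\<^sub>R k) \<partial>std_normal_distribution)
        \<le> (\<integral>\<sigma>. q (x + \<sigma> *\<^sub>R k) \<partial>std_normal_distribution) + C"
      unfolding C_def
    proof (rule gauss_shift_Young[OF \<alpha> \<beta> s, where K = "max K1 K2"])
      show "(\<lambda>\<sigma>. p (x + \<sigma> *\<^sub>R k)) \<in> borel_measurable borel"
        using trig_polys_measurable[OF p] by measurable
      show "(\<lambda>\<sigma>. q (x + \<sigma> *\<^sub>R k)) \<in> borel_measurable borel"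
        using trig_polys_measurable[OF q] by measurable
      show "\<bar>p (x + \<sigma> *\<^sub>R k)\<bar> \<le> max K1 K2" "\<bar>q (x + \<sigma> *\<^sub>R k)\<bar> \<le> max K1 K2" for \<sigma>
        using K1 K2 by (simp_all add: le_max_iff_disj)
    qed (rule pq)
    moreover have "(\<integral>\<sigma>. p (x + (\<sigma> + c) *\<^sub>R k) \<partial>std_normal_distribution)
        = Re (pairing ps (\<lambda>\<xi>. character (c *\<^sub>R k) \<xi> * g \<xi> * character x \<xi>))"
      unfolding ps smooth[symmetric] by (rule integral_Re_pairing[OF G.finite_measure_axioms]) simp
    moreover have "(\<integral>\<sigma>. q (x + \<sigma> *\<^sub>R k) \<partial>std_normal_distribution)
        = Re (pairing qs (\<lambda>\<xi>. g \<xi> * character x \<xi>))"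
    proof -
      have "(\<integral>\<sigma>. q (x + \<sigma> *\<^sub>R k) \<partial>std_normal_distribution)
          = Re (pairing qs (\<lambda>\<xi>. \<integral>\<sigma>. character (x + \<sigma> *\<^sub>R k) \<xi> \<partial>std_normal_distribution))"
        unfolding qs by (rule integral_Re_pairing[OF G.finite_measure_axioms]) simp
      then show ?thesis using smooth[of x 0] by simp
    qed
    ultimately show ?thesis unfolding L by (simp add: character_def)
  qed
  from character_positiveD[OF \<phi> this]
  have pos: "0 \<le> Re (pairing ?L \<phi>)" .
  have g\<phi>: "g \<xi> * \<phi> \<xi> = (\<integral>x. character x \<xi> \<partial>\<mu>)" for \<xi>
    unfolding factor g_def by (rule mult.commute)
  have "\<phi> 0 = 1" using factor[of 0] by (simp add: character_def \<mu>.prob_space)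
  moreover have "Re (pairing qs (\<lambda>\<xi>. g \<xi> * \<phi> \<xi>)) = (\<integral>w. q w \<partial>\<mu>)"
    unfolding g\<phi> qs by (rule integral_Re_pairing[symmetric, OF \<mu>.finite_measure_axioms]) simp
  moreover have "Re (pairing ps (\<lambda>\<xi>. character (c *\<^sub>R k) \<xi> * g \<xi> * \<phi> \<xi>)) = (\<integral>w. p (w + c *\<^sub>R k) \<partial>\<mu>)"
  proof -
    have "character (c *\<^sub>R k) \<xi> * g \<xi> * \<phi> \<xi> = (\<integral>w. character (w + c *\<^sub>R k) \<xi> \<partial>\<mu>)" for \<xi>
    proof -
      have "(\<integral>w. character (w + c *\<^sub>R k) \<xi> \<partial>\<mu>) = (\<integral>w. character w \<xi> \<partial>\<mu>) * character (c *\<^sub>R k) \<xi>"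
        unfolding character_add by (rule integral_mult_left_zero)
      then show ?thesis by (simp only: g\<phi>[symmetric] mult_ac)
    qed
    then show ?thesis
      unfolding ps
      by (subst integral_Re_pairing[OF \<mu>.finite_measure_axioms]) (simp_all only:, measurable)
  qed
  moreover note pos[unfolded L]
  ultimately show ?thesis unfolding C_def[symmetric] by simp
qed

section \<open>Density of trigonometric polynomials\<close>

text \<open>
  From \<open>|y|\<^sup>2 - |y - d|\<^sup>2 = 2 \<langle>d, y\<rangle> - |d|\<^sup>2\<close>: the norm is determined by the inner
  products with a dense set, which may be countable.
\<close>

lemma norm_gt_iff_dense:
  fixes y :: "'b::real_inner"
  assumes D: "\<And>X. open X \<Longrightarrow> X \<noteq> {} \<Longrightarrow> \<exists>d\<in>D. d \<in> X" and r: "0 \<le> r"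
  shows "r < norm y \<longleftrightarrow> (\<exists>d\<in>D. r\<^sup>2 + (norm d)\<^sup>2 < 2 * (d \<bullet> y))"
proof -
  have eq: "(norm (y - d))\<^sup>2 = (norm y)\<^sup>2 - 2 * (d \<bullet> y) + (norm d)\<^sup>2" for d
    by (simp add: power2_norm_eq_inner inner_diff inner_commute)
  show ?thesis
  proof
    assume "r < norm y"
    then have pos: "0 < (norm y)\<^sup>2 - r\<^sup>2" using r power_strict_mono[of r "norm y" 2] by simp
    then have "ball y (sqrt ((norm y)\<^sup>2 - r\<^sup>2)) \<noteq> {}" by simp
    then obtain d where d: "d \<in> D" "norm (y - d) < sqrt ((norm y)\<^sup>2 - r\<^sup>2)"
      using D[OF open_ball] by (metis dist_norm mem_ball)
    have "(norm (y - d))\<^sup>2 < (norm y)\<^sup>2 - r\<^sup>2"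
      using power_strict_mono[OF d(2), of 2] pos by simp
    then show "\<exists>d\<in>D. r\<^sup>2 + (norm d)\<^sup>2 < 2 * (d \<bullet> y)"
      using d(1) unfolding eq by (intro bexI[of _ d]) linarith+
  next
    assume "\<exists>d\<in>D. r\<^sup>2 + (norm d)\<^sup>2 < 2 * (d \<bullet> y)"
    then obtain d where "r\<^sup>2 + (norm d)\<^sup>2 < 2 * (d \<bullet> y)" by blast
    then have "r\<^sup>2 < (norm y)\<^sup>2" using eq[of d] zero_le_power2[of "norm (y - d)"] by linarith
    then show "r < norm y" by (rule power_less_imp_less_base) simp
  qed
qed

text \<open>
  Two measures are needed because the inequality compares integrals against a measure and its shift,
  and the same polynomial has to be close to \<open>f\<close> for both.
\<close>

locale finite_borel_pair = M: finite_measure M + N: finite_measure N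
  for M N :: "'a::{real_inner, second_countable_topology} measure" +
  assumes sets_M: "sets M = sets borel" and sets_N: "sets N = sets borel"
begin

lemma measurable_MN:
  "f \<in> borel_measurable borel \<Longrightarrow> f \<in> borel_measurable M"
  "f \<in> borel_measurable borel \<Longrightarrow> f \<in> borel_measurable N"
  by (simp_all only: measurable_cong_sets[OF sets_M refl] measurable_cong_sets[OF sets_N refl])

lemma integrable_bounded:
  fixes f :: "'a \<Rightarrow> real"
  assumes "f \<in> borel_measurable borel" "\<And>x. \<bar>f x\<bar> \<le> K"
  shows "integrable M f" "integrable N f"
  by (rule M.integrable_const_bound[of f K] N.integrable_const_bound[of f K];
      simp add: assms measurable_MN)+

definition err :: "('a \<Rightarrow> real) \<Rightarrow> real" where
  "err f = (\<integral>x. \<bar>f x\<bar> \<partial>M) + (\<integral>x. \<bar>f x\<bar> \<partial>N)"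

lemma err_le_add:
  fixes f g h :: "'a \<Rightarrow> real"
  assumes f: "f \<in> borel_measurable borel"
    and g: "g \<in> borel_measurable borel" "\<And>x. \<bar>g x\<bar> \<le> K"
    and h: "h \<in> borel_measurable borel" "\<And>x. \<bar>h x\<bar> \<le> L"
    and le: "\<And>x. \<bar>f x\<bar> \<le> \<bar>g x\<bar> + \<bar>h x\<bar>"
  shows "err f \<le> err g + err h"
proof -
  have fb: "\<bar>\<bar>f x\<bar>\<bar> \<le> K + L" for x using le[of x] g(2)[of x] h(2)[of x] by simp
  have i: "integrable M (\<lambda>x. \<bar>f x\<bar>)" "integrable N (\<lambda>x. \<bar>f x\<bar>)"
    by (rule integrable_bounded[of "\<lambda>x. \<bar>f x\<bar>" "K + L"]; use f fb in simp)+
  have j: "integrable M (\<lambda>x. \<bar>g x\<bar>)" "integrable N (\<lambda>x. \<bar>g x\<bar>)"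
    by (rule integrable_bounded[of "\<lambda>x. \<bar>g x\<bar>" K]; use g in simp)+
  have k: "integrable M (\<lambda>x. \<bar>h x\<bar>)" "integrable N (\<lambda>x. \<bar>h x\<bar>)"
    by (rule integrable_bounded[of "\<lambda>x. \<bar>h x\<bar>" L]; use h in simp)+
  have "(\<integral>x. \<bar>f x\<bar> \<partial>M) \<le> (\<integral>x. \<bar>g x\<bar> + \<bar>h x\<bar> \<partial>M)"
    by (rule integral_mono[OF i(1)]) (use j k le in auto)
  moreover have "(\<integral>x. \<bar>f x\<bar> \<partial>N) \<le> (\<integral>x. \<bar>g x\<bar> + \<bar>h x\<bar> \<partial>N)"
    by (rule integral_mono[OF i(2)]) (use j k le in auto)
  ultimately show ?thesis unfolding err_def using j k by simp
qed

lemma err_scale: "err (\<lambda>x. c * f x) = \<bar>c\<bar> * err f"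
  unfolding err_def by (simp add: abs_mult distrib_left)

lemma err_bound:
  fixes f :: "'a \<Rightarrow> real"
  assumes "f \<in> borel_measurable borel" "\<And>x. \<bar>f x\<bar> \<le> c"
  shows "err f \<le> c * (measure M (space M) + measure N (space N))"
proof -
  have i: "integrable M (\<lambda>x. \<bar>f x\<bar>)" "integrable N (\<lambda>x. \<bar>f x\<bar>)"
    by (rule integrable_bounded[of "\<lambda>x. \<bar>f x\<bar>" c]; use assms in simp)+
  have "(\<integral>x. \<bar>f x\<bar> \<partial>M) \<le> (\<integral>x. c \<partial>M)" "(\<integral>x. \<bar>f x\<bar> \<partial>N) \<le> (\<integral>x. c \<partial>N)"
    by (intro integral_mono i; use assms in simp)+
  then show ?thesis unfolding err_def by (simp add: algebra_simps)
qed

lemma err_tendsto_0: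
  fixes f :: "nat \<Rightarrow> 'a \<Rightarrow> real"
  assumes f: "\<And>n. f n \<in> borel_measurable borel" "\<And>n x. \<bar>f n x\<bar> \<le> K"
    and lim: "\<And>x. (\<lambda>n. f n x) \<longlonglongrightarrow> 0"
  shows "(\<lambda>n. err (f n)) \<longlonglongrightarrow> 0"
proof -
  have abs0: "(\<lambda>n. \<bar>f n x\<bar>) \<longlonglongrightarrow> 0" for x using lim tendsto_rabs_zero by blast
  have limM: "(\<lambda>n. \<integral>x. \<bar>f n x\<bar> \<partial>M) \<longlonglongrightarrow> (\<integral>x. 0 \<partial>M)"
    by (rule integral_dominated_convergence[where w = "\<lambda>_. K"])
       (use f(2) in \<open>simp_all add: abs0 borel_measurable_abs measurable_MN(1)[OF f(1)]\<close>)
  have limN: "(\<lambda>n. \<integral>x. \<bar>f n x\<bar> \<partial>N) \<longlonglongrightarrow> (\<integral>x. 0 \<partial>N)"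
    by (rule integral_dominated_convergence[where w = "\<lambda>_. K"])
       (use f(2) in \<open>simp_all add: abs0 borel_measurable_abs measurable_MN(2)[OF f(1)]\<close>)
  show ?thesis unfolding err_def using tendsto_add[OF limM limN] by simp
qed

definition approximable :: "('a \<Rightarrow> real) \<Rightarrow> bool" where
  "approximable f \<longleftrightarrow> f \<in> borel_measurable borel \<and> (\<exists>K. \<forall>x. \<bar>f x\<bar> \<le> K) \<and>
     (\<forall>\<epsilon>>0. \<exists>p\<in>trig_polys. err (\<lambda>x. f x - p x) < \<epsilon>)"

lemma approximableE:
  assumes "approximable f"
  obtains K where "f \<in> borel_measurable borel" "0 \<le> K" "\<And>x. \<bar>f x\<bar> \<le> K"
    "\<And>\<epsilon>. 0 < \<epsilon> \<Longrightarrow> \<exists>p\<in>trig_polys. err (\<lambda>x. f x - p x) < \<epsilon>"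
proof -
  obtain K where K: "\<forall>x. \<bar>f x\<bar> \<le> K" using assms unfolding approximable_def by blast
  moreover have "0 \<le> K" using K abs_ge_zero order_trans by blast
  ultimately show thesis using that[of K] assms unfolding approximable_def by blast
qed

lemma approximable_uniform:
  fixes f :: "'a \<Rightarrow> real"
  assumes f: "f \<in> borel_measurable borel"
    and u: "\<And>\<epsilon>. 0 < \<epsilon> \<Longrightarrow> \<exists>p\<in>trig_polys. \<forall>x. \<bar>f x - p x\<bar> \<le> \<epsilon>"
  shows "approximable f"
  unfolding approximable_def
proof (intro conjI allI impI f)
  obtain p where p: "p \<in> trig_polys" "\<And>x. \<bar>f x - p x\<bar> \<le> 1" using u[of 1] by auto
  obtain K where K: "\<And>x. \<bar>p x\<bar> \<le> K" using trig_polys_bounded[OF p(1)] by blast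
  have "\<bar>f x\<bar> \<le> K + 1" for x using p(2)[of x] K[of x] by linarith
  then show "\<exists>K. \<forall>x. \<bar>f x\<bar> \<le> K" by blast
next
  fix \<epsilon> :: real assume \<epsilon>: "0 < \<epsilon>"
  define T where "T = measure M (space M) + measure N (space N) + 1"
  have T: "0 < T" unfolding T_def by (simp add: add_nonneg_pos)
  obtain p where p: "p \<in> trig_polys" "\<And>x. \<bar>f x - p x\<bar> \<le> \<epsilon> / T / 2"
    using u[of "\<epsilon> / T / 2"] \<epsilon> T by auto
  have "err (\<lambda>x. f x - p x) \<le> \<epsilon> / T / 2 * (measure M (space M) + measure N (space N))"
    by (rule err_bound) (use f p trig_polys_measurable[OF p(1)] in auto)
  also have "\<dots> \<le> \<epsilon> / T / 2 * T"
    using \<epsilon> T by (intro mult_left_mono) (auto simp: T_def)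
  also have "\<dots> < \<epsilon>" using \<epsilon> T by simp
  finally show "\<exists>p\<in>trig_polys. err (\<lambda>x. f x - p x) < \<epsilon>" using p(1) by blast
qed

lemma approximable_compose:
  assumes p: "p \<in> trig_polys" and \<psi>: "continuous_on UNIV \<psi>"
  shows "approximable (\<lambda>x. \<psi> (p x))"
proof (rule approximable_uniform)
  show "(\<lambda>x. \<psi> (p x)) \<in> borel_measurable borel"
    using trig_polys_measurable[OF p] borel_measurable_continuous_onI[OF \<psi>] by measurable
qed (rule trig_polys_approximation[OF p \<psi>])

lemma approximable_const: "approximable (\<lambda>x. c)"
  by (rule approximable_uniform) (auto intro!: bexI[OF _ trig_polys_const[of c]])

lemma approximable_add:
  assumes f: "approximable f" and g: "approximable g"
  shows "approximable (\<lambda>x. f x + g x)"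
proof -
  obtain K where K: "f \<in> borel_measurable borel" "\<And>x. \<bar>f x\<bar> \<le> K"
    "\<And>\<epsilon>. 0 < \<epsilon> \<Longrightarrow> \<exists>p\<in>trig_polys. err (\<lambda>x. f x - p x) < \<epsilon>" by (rule approximableE[OF f]) blast
  obtain L where L: "g \<in> borel_measurable borel" "\<And>x. \<bar>g x\<bar> \<le> L"
    "\<And>\<epsilon>. 0 < \<epsilon> \<Longrightarrow> \<exists>p\<in>trig_polys. err (\<lambda>x. g x - p x) < \<epsilon>" by (rule approximableE[OF g]) blast
  show ?thesis unfolding approximable_def
  proof (intro conjI allI impI)
    show "(\<lambda>x. f x + g x) \<in> borel_measurable borel" using K(1) L(1) by measurable
    have "\<bar>f x + g x\<bar> \<le> K + L" for x using K(2)[of x] L(2)[of x] by linarith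
    then show "\<exists>K. \<forall>x. \<bar>f x + g x\<bar> \<le> K" by blast
    fix \<epsilon> :: real assume "0 < \<epsilon>"
    then obtain p q where p: "p \<in> trig_polys" "err (\<lambda>x. f x - p x) < \<epsilon> / 2"
      and q: "q \<in> trig_polys" "err (\<lambda>x. g x - q x) < \<epsilon> / 2"
      using K(3)[of "\<epsilon> / 2"] L(3)[of "\<epsilon> / 2"] by auto
    obtain P Q where P: "\<And>x. \<bar>p x\<bar> \<le> P" and Q: "\<And>x. \<bar>q x\<bar> \<le> Q"
      using trig_polys_bounded p(1) q(1) by meson
    note [measurable] = K(1) L(1) trig_polys_measurable[OF p(1)] trig_polys_measurable[OF q(1)]
    have "err (\<lambda>x. f x + g x - (p x + q x)) \<le> err (\<lambda>x. f x - p x) + err (\<lambda>x. g x - q x)"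
    proof (rule err_le_add)
      show "\<bar>f x - p x\<bar> \<le> K + P" for x using K(2)[of x] P[of x] by linarith
      show "\<bar>g x - q x\<bar> \<le> L + Q" for x using L(2)[of x] Q[of x] by linarith
      show "\<bar>f x + g x - (p x + q x)\<bar> \<le> \<bar>f x - p x\<bar> + \<bar>g x - q x\<bar>" for x by linarith
    qed measurable
    then have "err (\<lambda>x. f x + g x - (p x + q x)) < \<epsilon>" using p(2) q(2) by linarith
    then show "\<exists>p\<in>trig_polys. err (\<lambda>x. f x + g x - p x) < \<epsilon>"
      by (intro bexI[OF _ trig_polys_add[OF p(1) q(1)]])
  qed
qed

text \<open>
  The polynomial for \<open>f\<close> is chosen first; its sup norm then dictates how well \<open>g\<close> must be
  approximated.
\<close>

lemma approximable_mult:
  assumes f: "approximable f" and g: "approximable g"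
  shows "approximable (\<lambda>x. f x * g x)"
proof -
  obtain K where K: "f \<in> borel_measurable borel" "0 \<le> K" "\<And>x. \<bar>f x\<bar> \<le> K"
    "\<And>\<epsilon>. 0 < \<epsilon> \<Longrightarrow> \<exists>p\<in>trig_polys. err (\<lambda>x. f x - p x) < \<epsilon>" by (rule approximableE[OF f]) blast
  obtain L where L: "g \<in> borel_measurable borel" "0 \<le> L" "\<And>x. \<bar>g x\<bar> \<le> L"
    "\<And>\<epsilon>. 0 < \<epsilon> \<Longrightarrow> \<exists>p\<in>trig_polys. err (\<lambda>x. g x - p x) < \<epsilon>" by (rule approximableE[OF g]) blast
  show ?thesis unfolding approximable_def
  proof (intro conjI allI impI)
    show "(\<lambda>x. f x * g x) \<in> borel_measurable borel" using K(1) L(1) by measurable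
    have "\<bar>f x * g x\<bar> \<le> K * L" for x
      unfolding abs_mult by (intro mult_mono K L abs_ge_zero)
    then show "\<exists>K. \<forall>x. \<bar>f x * g x\<bar> \<le> K" by blast
    fix \<epsilon> :: real assume \<epsilon>: "0 < \<epsilon>"
    obtain p where p: "p \<in> trig_polys" "err (\<lambda>x. f x - p x) < \<epsilon> / 2 / (L + 1)"
      using K(4)[of "\<epsilon> / 2 / (L + 1)"] \<epsilon> L(2) by auto
    obtain P where P: "0 \<le> P" "\<And>x. \<bar>p x\<bar> \<le> P" using trig_polys_bounded[OF p(1)] by blast
    obtain q where q: "q \<in> trig_polys" "err (\<lambda>x. g x - q x) < \<epsilon> / 2 / (P + 1)"
      using L(4)[of "\<epsilon> / 2 / (P + 1)"] \<epsilon> P(1) by auto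
    obtain Q where Q: "0 \<le> Q" "\<And>x. \<bar>q x\<bar> \<le> Q" using trig_polys_bounded[OF q(1)] by blast
    note [measurable] = K(1) L(1) trig_polys_measurable[OF p(1)] trig_polys_measurable[OF q(1)]
    have "err (\<lambda>x. f x * g x - p x * q x)
        \<le> err (\<lambda>x. (L + 1) * (f x - p x)) + err (\<lambda>x. (P + 1) * (g x - q x))"
    proof (rule err_le_add)
      show "\<bar>(L + 1) * (f x - p x)\<bar> \<le> (L + 1) * (K + P)" for x
        unfolding abs_mult using L(2) K(2) K(3)[of x] P(1) P(2)[of x] by (intro mult_mono) auto
      show "\<bar>(P + 1) * (g x - q x)\<bar> \<le> (P + 1) * (L + Q)" for x
        unfolding abs_mult using P(1) L(2) L(3)[of x] Q(1) Q(2)[of x] by (intro mult_mono) auto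
      show "\<bar>f x * g x - p x * q x\<bar> \<le> \<bar>(L + 1) * (f x - p x)\<bar> + \<bar>(P + 1) * (g x - q x)\<bar>" for x
      proof -
        have "f x * g x - p x * q x = g x * (f x - p x) + p x * (g x - q x)" by (simp add: algebra_simps)
        then have "\<bar>f x * g x - p x * q x\<bar> \<le> \<bar>g x\<bar> * \<bar>f x - p x\<bar> + \<bar>p x\<bar> * \<bar>g x - q x\<bar>"
          using abs_triangle_ineq[of "g x * (f x - p x)" "p x * (g x - q x)"] by (simp add: abs_mult)
        also have "\<dots> \<le> (L + 1) * \<bar>f x - p x\<bar> + (P + 1) * \<bar>g x - q x\<bar>"
          using L(3)[of x] P(2)[of x] by (intro add_mono mult_right_mono) auto
        finally show ?thesis using L(2) P(1) by (simp add: abs_mult)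
      qed
    qed measurable
    also have "\<dots> = (L + 1) * err (\<lambda>x. f x - p x) + (P + 1) * err (\<lambda>x. g x - q x)"
      using L(2) P(1) by (simp only: err_scale)
    also have "\<dots> < \<epsilon> / 2 + \<epsilon> / 2"
    proof (rule add_strict_mono)
      have "(L + 1) * err (\<lambda>x. f x - p x) < (L + 1) * (\<epsilon> / 2 / (L + 1))"
        by (rule mult_strict_left_mono[OF p(2)]) (use L(2) in simp)
      also have "\<dots> = \<epsilon> / 2"
        by (subst times_divide_eq_right, rule nonzero_mult_div_cancel_left) (use L(2) in linarith)
      finally show "(L + 1) * err (\<lambda>x. f x - p x) < \<epsilon> / 2" .
      have "(P + 1) * err (\<lambda>x. g x - q x) < (P + 1) * (\<epsilon> / 2 / (P + 1))"
        by (rule mult_strict_left_mono[OF q(2)]) (use P(1) in simp)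
      also have "\<dots> = \<epsilon> / 2"
        by (subst times_divide_eq_right, rule nonzero_mult_div_cancel_left) (use P(1) in linarith)
      finally show "(P + 1) * err (\<lambda>x. g x - q x) < \<epsilon> / 2" .
    qed
    finally have "err (\<lambda>x. f x * g x - p x * q x) < \<epsilon>" by simp
    then show "\<exists>p\<in>trig_polys. err (\<lambda>x. f x * g x - p x) < \<epsilon>"
      by (intro bexI[OF _ trig_polys_mult[OF p(1) q(1)]])
  qed
qed

lemma approximable_limit:
  fixes f :: "nat \<Rightarrow> 'a \<Rightarrow> real"
  assumes f: "\<And>n. approximable (f n)" and b: "\<And>n x. \<bar>f n x\<bar> \<le> K"
    and lim: "\<And>x. (\<lambda>n. f n x) \<longlonglongrightarrow> g x"
  shows "approximable g"
  unfolding approximable_def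
proof (intro conjI allI impI)
  have fm [measurable]: "f n \<in> borel_measurable borel" for n using f unfolding approximable_def by blast
  show gm [measurable]: "g \<in> borel_measurable borel"
    by (rule borel_measurable_LIMSEQ_real[of borel f g]) (use lim fm in auto)
  have gK: "\<bar>g x\<bar> \<le> K" for x
    by (rule LIMSEQ_le_const2[OF tendsto_rabs[OF lim]]) (use b in blast)
  then show "\<exists>K. \<forall>x. \<bar>g x\<bar> \<le> K" by blast
  fix \<epsilon> :: real assume \<epsilon>: "0 < \<epsilon>"
  have db: "\<bar>g x - f n x\<bar> \<le> 2 * K" for n x using gK[of x] b[of n x] by linarith
  have "(\<lambda>n. err (\<lambda>x. g x - f n x)) \<longlonglongrightarrow> 0"
  proof (rule err_tendsto_0[OF _ db])
    show "(\<lambda>n. g x - f n x) \<longlonglongrightarrow> 0" for x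
      using tendsto_diff[OF tendsto_const lim[of x], of "g x"] by simp
  qed measurable
  then have "\<forall>\<^sub>F n in sequentially. err (\<lambda>x. g x - f n x) < \<epsilon> / 2"
    by (rule order_tendstoD) (use \<epsilon> in simp)
  then obtain n where n: "err (\<lambda>x. g x - f n x) < \<epsilon> / 2"
    by (auto simp: eventually_sequentially)
  obtain p where p: "p \<in> trig_polys" "err (\<lambda>x. f n x - p x) < \<epsilon> / 2"
    using f[of n] \<epsilon> unfolding approximable_def by (meson half_gt_zero)
  obtain P where P: "\<And>x. \<bar>p x\<bar> \<le> P" using trig_polys_bounded[OF p(1)] by blast
  note [measurable] = trig_polys_measurable[OF p(1)]
  have "err (\<lambda>x. g x - p x) \<le> err (\<lambda>x. g x - f n x) + err (\<lambda>x. f n x - p x)"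
  proof (rule err_le_add[OF _ _ db])
    show "\<bar>f n x - p x\<bar> \<le> K + P" for x using b[of n x] P[of x] by linarith
    show "\<bar>g x - p x\<bar> \<le> \<bar>g x - f n x\<bar> + \<bar>f n x - p x\<bar>" for x by linarith
  qed measurable
  then have "err (\<lambda>x. g x - p x) < \<epsilon>" using n p(2) by linarith
  then show "\<exists>p\<in>trig_polys. err (\<lambda>x. g x - p x) < \<epsilon>" using p(1) by blast
qed

definition approximable_sets :: "'a set set" where
  "approximable_sets = {A. approximable (indicator A)}"

lemma approximable_sets_compl:
  assumes "A \<in> approximable_sets"
  shows "- A \<in> approximable_sets"
proof -
  have "approximable (\<lambda>x. 1 + (- 1) * indicator A x)"
    using assms unfolding approximable_sets_def
    by (intro approximable_add approximable_mult approximable_const) simp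
  moreover have "(\<lambda>x. 1 + (- 1) * indicator A x) = (indicator (- A) :: 'a \<Rightarrow> real)"
    by (auto simp: indicator_def)
  ultimately show ?thesis unfolding approximable_sets_def by simp
qed

lemma approximable_sets_Int:
  assumes "A \<in> approximable_sets" "B \<in> approximable_sets"
  shows "A \<inter> B \<in> approximable_sets"
proof -
  have "approximable (\<lambda>x. indicator A x * indicator B x)"
    using assms unfolding approximable_sets_def by (intro approximable_mult) simp_all
  moreover have "(\<lambda>x. indicator A x * indicator B x) = (indicator (A \<inter> B) :: 'a \<Rightarrow> real)"
    by (auto simp: indicator_def)
  ultimately show ?thesis unfolding approximable_sets_def by simp
qed

lemma approximable_sets_UN:
  fixes A :: "nat \<Rightarrow> 'a set"
  assumes A: "\<And>i. A i \<in> approximable_sets"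
  shows "(\<Union>i. A i) \<in> approximable_sets"
proof -
  have fin: "(\<Union>i<n. A i) \<in> approximable_sets" for n
  proof (induction n)
    case 0
    have "(indicator {} :: 'a \<Rightarrow> real) = (\<lambda>_. 0)" by auto
    then show ?case using approximable_const[of 0] by (simp add: approximable_sets_def)
  next
    case (Suc n)
    have "(\<Union>i<Suc n. A i) = - (- (\<Union>i<n. A i) \<inter> - A n)" by (auto simp: less_Suc_eq)
    then show ?case using Suc A by (metis approximable_sets_Int approximable_sets_compl)
  qed
  have "approximable (indicator (\<Union>i. A i))"
  proof (rule approximable_limit[where K = 1])
    show "approximable (indicator (\<Union>i<n. A i))" for n
      using fin[of n] unfolding approximable_sets_def by simp
    show "\<bar>indicator (\<Union>i<n. A i) x :: real\<bar> \<le> 1" for n x by (simp add: indicator_def)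
    show "(\<lambda>n. indicator (\<Union>i<n. A i) x :: real) \<longlonglongrightarrow> indicator (\<Union>i. A i) x" for x
      by (rule LIMSEQ_indicator_UN)
  qed
  then show ?thesis unfolding approximable_sets_def by simp
qed

lemma sigma_algebra_approximable_sets: "sigma_algebra UNIV approximable_sets"
  unfolding sigma_algebra_iff2
proof (intro conjI)
  have "(indicator {} :: 'a \<Rightarrow> real) = (\<lambda>_. 0)" by auto
  then show "{} \<in> approximable_sets" using approximable_const[of 0] by (simp add: approximable_sets_def)
  show "\<forall>A. range A \<subseteq> approximable_sets \<longrightarrow> (\<Union>i::nat. A i) \<in> approximable_sets"
    by (intro allI impI approximable_sets_UN) auto
qed (use approximable_sets_compl in \<open>auto simp: Compl_eq_Diff_UNIV\<close>)

text \<open>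
  Treating the approximable sets as a measurable space lets the closure properties of measurable
  functions show that they include all Borel sets.
\<close>

definition approximable_space :: "'a measure" where
  "approximable_space = sigma UNIV approximable_sets"

lemma space_approximable_space [simp]: "space approximable_space = UNIV"
  unfolding approximable_space_def by simp

lemma sets_approximable_space: "sets approximable_space = approximable_sets"
  unfolding approximable_space_def
  by (simp add: sigma_algebra.sigma_sets_eq[OF sigma_algebra_approximable_sets])

text \<open>
  The indicator of \<open>{p > c}\<close> is the limit of continuous functions of \<open>p\<close>, each of which is a uniform
  limit of trigonometric polynomials.
\<close>

lemma trig_polys_measurable_approximable:
  assumes p: "p \<in> trig_polys"
  shows "p \<in> borel_measurable approximable_space"
  unfolding borel_measurable_iff_greater
proof
  fix c
  have "approximable (indicator {x. c < p x})"
  proof (rule approximable_limit[where K = 1])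
    let ?\<psi> = "\<lambda>n t. min 1 (max 0 (real n * (t - c)))"
    show "approximable (\<lambda>x. ?\<psi> n (p x))" for n
      by (rule approximable_compose[OF p]) (intro continuous_intros)
    show "\<bar>?\<psi> n (p x)\<bar> \<le> 1" for n x by auto
    show "(\<lambda>n. ?\<psi> n (p x)) \<longlonglongrightarrow> indicator {x. c < p x} x" for x
    proof (cases "c < p x")
      case True
      then obtain m :: nat where m: "1 < real m * (p x - c)"
        using ex_less_of_nat_mult[of "p x - c" 1] by auto
      have ge: "1 \<le> real n * (p x - c)" if "m \<le> n" for n
      proof -
        have "real m * (p x - c) \<le> real n * (p x - c)"
          by (rule mult_right_mono) (use that True in auto)
        then show ?thesis using m by linarith
      qed
      then have "\<forall>\<^sub>F n in sequentially. ?\<psi> n (p x) = 1"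
        unfolding eventually_sequentially
      proof (intro exI[of _ m] allI impI)
        fix n assume "m \<le> n"
        then show "?\<psi> n (p x) = 1" using ge[of n] by linarith
      qed
      then show ?thesis using True by (simp add: tendsto_eventually)
    next
      case False
      then have "real n * (p x - c) \<le> 0" for n by (simp add: mult_le_0_iff)
      then have "?\<psi> n (p x) = 0" for n by (simp add: max_absorb1)
      then show ?thesis using False by simp
    qed
  qed
  then show "{w \<in> space approximable_space. c < p w} \<in> sets approximable_space"
    by (simp add: sets_approximable_space approximable_sets_def)
qed

text \<open>
  A linear form is the limit of the trigonometric polynomials \<open>n sin(\<langle>\<xi>, x\<rangle> / n)\<close>.
\<close>

lemma inner_measurable_approximable: "(\<lambda>x. \<xi> \<bullet> x) \<in> borel_measurable approximable_space"
proof (rule borel_measurable_LIMSEQ_real)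
  let ?h = "\<lambda>n. 1 / real (Suc n)"
  show "(\<lambda>x. sin ((\<xi> \<bullet> x) * ?h n) / ?h n) \<in> borel_measurable approximable_space" for n
  proof -
    have "(\<lambda>x. sin ((\<xi> \<bullet> x) * ?h n)) = (\<lambda>x. Re (pairing [(- \<i>, ?h n *\<^sub>R \<xi>)] (character x)))"
      by (auto simp: character_def exp_Euler mult.commute Re_exp Im_exp sin_of_real)
    then have "(\<lambda>x. sin ((\<xi> \<bullet> x) * ?h n)) \<in> trig_polys" unfolding trig_polys_def by blast
    from borel_measurable_divide[OF trig_polys_measurable_approximable[OF this] borel_measurable_const]
    show ?thesis .
  qed
  fix x
  have "((\<lambda>h. sin ((\<xi> \<bullet> x) * h)) has_real_derivative \<xi> \<bullet> x) (at 0)"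
    by (auto intro!: derivative_eq_intros)
  then have lim: "(\<lambda>h. sin ((\<xi> \<bullet> x) * h) / h) \<midarrow>0\<rightarrow> \<xi> \<bullet> x" by (simp add: DERIV_def)
  have "?h \<longlonglongrightarrow> 0" using LIMSEQ_inverse_real_of_nat by (simp add: inverse_eq_divide)
  then show "(\<lambda>n. sin ((\<xi> \<bullet> x) * ?h n) / ?h n) \<longlonglongrightarrow> \<xi> \<bullet> x"
    by (intro LIMSEQ_SEQ_conv[THEN iffD2, OF lim, rule_format, of ?h]) simp
qed

text \<open>
  Linear forms determine the distance to a point, hence balls, and by separability every open set is
  a countable union of balls.
\<close>

lemma borel_subset_approximable_sets: "sets borel \<subseteq> approximable_sets"
proof -
  obtain D :: "'a set" where D: "countable D" "\<And>X. open X \<Longrightarrow> X \<noteq> {} \<Longrightarrow> \<exists>d\<in>D. d \<in> X"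
    using countable_dense_setE by blast
  have dist_meas: "(\<lambda>x. dist a x) \<in> borel_measurable approximable_space" for a
    unfolding borel_measurable_iff_greater
  proof
    fix r :: real
    show "{x \<in> space approximable_space. r < dist a x} \<in> sets approximable_space"
    proof (cases "0 \<le> r")
      case True
      have "{x \<in> space approximable_space. r < dist a x}
          = (\<Union>d\<in>D. {x \<in> space approximable_space. r\<^sup>2 + (norm d)\<^sup>2 < 2 * (d \<bullet> x - d \<bullet> a)})"
        using norm_gt_iff_dense[OF D(2) True] by (auto simp: dist_norm norm_minus_commute inner_diff_right)
      moreover have "{x \<in> space approximable_space. r\<^sup>2 + (norm d)\<^sup>2 < 2 * (d \<bullet> x - d \<bullet> a)}
          \<in> sets approximable_space" for d
        using inner_measurable_approximable[of d] by measurable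
      ultimately show ?thesis using D(1) by (simp only:) (intro sets.countable_UN''; simp)
    next
      case False
      have "r < dist a x" for x using False zero_le_dist[of a x] by linarith
      then have "{x \<in> space approximable_space. r < dist a x} = space approximable_space" by simp
      then show ?thesis by (simp only: sets.top)
    qed
  qed
  have "X \<in> sets approximable_space" if "open X" for X
  proof -
    let ?F = "{ball a r |a r. ball a r \<subseteq> X}"
    obtain F where F: "F \<subseteq> ?F" "countable F" "\<Union>F = \<Union>?F"
      using Lindelof[of ?F] by blast
    have "\<Union>?F = X"
    proof
      show "X \<subseteq> \<Union>?F"
      proof
        fix x assume "x \<in> X"
        then obtain e where "0 < e" "ball x e \<subseteq> X" using \<open>open X\<close> open_contains_ball by blast
        then show "x \<in> \<Union>?F" by (intro UnionI[of "ball x e"]) auto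
      qed
    qed blast
    moreover have "B \<in> sets approximable_space" if BF: "B \<in> F" for B
    proof -
      obtain a r where B: "B = ball a r" using subsetD[OF F(1) BF] by auto
      have "{x \<in> space approximable_space. dist a x < r} \<in> sets approximable_space"
        using dist_meas[of a] by measurable
      then show ?thesis unfolding B ball_def by simp
    qed
    ultimately show ?thesis using F(2,3) sets.countable_Union[of F approximable_space] by auto
  qed
  then have "sigma_sets UNIV {X. open X} \<subseteq> sets approximable_space"
    using sets.sigma_sets_subset[of "{X. open X}" approximable_space] by auto
  then show ?thesis unfolding sets_approximable_space borel_def by simp
qed

theorem bounded_borel_approximable:
  fixes f :: "'a \<Rightarrow> real"
  assumes f: "f \<in> borel_measurable borel" and nonneg: "\<And>x. 0 \<le> f x" and bdd: "\<And>x. f x \<le> B"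
  shows "approximable f"
proof -
  have "\<forall>B. (\<forall>x. f x \<le> B) \<longrightarrow> approximable f"
    using f nonneg
  proof (induction rule: borel_measurable_induct_real)
    case (set A)
    then show ?case using borel_subset_approximable_sets unfolding approximable_sets_def by blast
  next
    case (mult u c)
    show ?case
    proof (intro allI impI)
      fix B assume B: "\<forall>x. c * u x \<le> B"
      show "approximable (\<lambda>x. c * u x)"
      proof (cases "c = 0")
        case True
        then show ?thesis using approximable_const[of 0] by simp
      next
        case False
        then have "\<forall>x. u x \<le> B / c" using B mult.hyps(1) by (simp add: pos_le_divide_eq mult.commute)
        then have "approximable u" using mult by blast
        then show ?thesis by (intro approximable_mult approximable_const)
      qed
    qed
  next
    case (add u v)
    show ?case
    proof (intro allI impI)
      fix B assume B: "\<forall>x. v x + u x \<le> B"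
      have "u x \<le> B" "v x \<le> B" for x
        using B[rule_format, of x] add.hyps(2)[of x] add.hyps(4)[of x] by linarith+
      then show "approximable (\<lambda>x. v x + u x)" using add by (blast intro: approximable_add)
    qed
  next
    case (seq U)
    show ?case
    proof (intro allI impI)
      fix B assume B: "\<forall>x. f x \<le> B"
      have le: "U i x \<le> B" for i x
      proof -
        have "incseq (\<lambda>i. U i x)" using seq.hyps(3) by (auto simp: incseq_def le_fun_def)
        from incseq_le[OF this seq.hyps(4)[of x]] show ?thesis using B order_trans by (metis UNIV_I space_borel)
      qed
      show "approximable f"
      proof (rule approximable_limit[where K = B])
        show "approximable (U i)" for i using seq le by blast
        show "\<bar>U i x\<bar> \<le> B" for i x using le[of i x] seq.hyps(2)[of i x] by simp
        show "(\<lambda>i. U i x) \<longlonglongrightarrow> f x" for x using seq.hyps(4)[of x] by simp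
      qed
    qed
  qed
  then show ?thesis using bdd by blast
qed

end

section \<open>The power inequality for shifts\<close>

text \<open>
  The tangent inequality for the convex power function, obtained from Young's inequality; it serves
  as a Lipschitz bound on \<open>[0, B]\<close> and covers the origin, where differentiation would need care.
\<close>

lemma powr_tangent_bound:
  fixes a b \<alpha> B :: real
  assumes \<alpha>: "1 < \<alpha>" and a: "0 \<le> a" "a \<le> B" and b: "0 \<le> b"
  shows "a powr \<alpha> \<le> b powr \<alpha> + \<alpha> * B powr (\<alpha> - 1) * \<bar>a - b\<bar>"
proof (cases "a \<le> b")
  case True
  then have "a powr \<alpha> \<le> b powr \<alpha>" using \<alpha> a by (intro powr_mono2) auto
  moreover have "0 \<le> \<alpha> * B powr (\<alpha> - 1) * \<bar>a - b\<bar>" using \<alpha> by simp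
  ultimately show ?thesis by linarith
next
  case False
  have "a powr (\<alpha> - 1) * b \<le> 1 / \<alpha> * (max 0 b) powr \<alpha>
      + 1 powr (1 - \<alpha> / (\<alpha> - 1)) / (\<alpha> / (\<alpha> - 1)) * (a powr (\<alpha> - 1)) powr (\<alpha> / (\<alpha> - 1))"
    by (rule weighted_Young[OF \<alpha> refl]) auto
  also have "(a powr (\<alpha> - 1)) powr (\<alpha> / (\<alpha> - 1)) = a powr \<alpha>" using \<alpha> by (simp add: powr_powr)
  finally have "a powr (\<alpha> - 1) * b \<le> b powr \<alpha> / \<alpha> + (\<alpha> - 1) / \<alpha> * a powr \<alpha>" using b by simp
  then have "\<alpha> * (a powr (\<alpha> - 1) * b) \<le> \<alpha> * (b powr \<alpha> / \<alpha> + (\<alpha> - 1) / \<alpha> * a powr \<alpha>)"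
    using \<alpha> by (intro mult_left_mono) auto
  also have "\<dots> = b powr \<alpha> + (\<alpha> - 1) * a powr \<alpha>" using \<alpha> by (simp add: distrib_left)
  finally have *: "\<alpha> * (a powr (\<alpha> - 1) * b) \<le> b powr \<alpha> + (\<alpha> - 1) * a powr \<alpha>" .
  have "a powr (\<alpha> - 1) * a = a powr \<alpha>"
    using False b powr_add[of a "\<alpha> - 1" 1] by simp
  then have "a powr \<alpha> \<le> b powr \<alpha> + \<alpha> * (a powr (\<alpha> - 1) * (a - b))"
    using * by (simp add: algebra_simps)
  also have "\<alpha> * (a powr (\<alpha> - 1) * (a - b)) \<le> \<alpha> * (B powr (\<alpha> - 1) * (a - b))"
    using \<alpha> a False by (intro mult_left_mono mult_right_mono powr_mono2) auto
  finally show ?thesis using False by (simp add: mult.assoc)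
qed

lemma le_if_le_add_small:
  fixes X Y D :: real
  assumes "0 \<le> D" and le: "\<And>\<epsilon>. 0 < \<epsilon> \<Longrightarrow> \<epsilon> \<le> 1 \<Longrightarrow> X \<le> Y + \<epsilon> * D"
  shows "X \<le> Y"
proof (rule field_le_epsilon)
  fix e :: real assume e: "0 < e"
  let ?\<epsilon> = "min 1 (e / (D + 1))"
  have "X \<le> Y + ?\<epsilon> * D" using e assms(1) by (intro le) auto
  also have "?\<epsilon> * D \<le> e / (D + 1) * (D + 1)"
    using e assms(1) by (intro mult_mono) auto
  finally show "X \<le> Y + e" using assms(1) by simp
qed

text \<open>
  Let \<open>p\<close> be a trigonometric polynomial close to \<open>g\<close> and \<open>\<psi>\<close> the truncation to \<open>[0, B]\<close>, which only
  brings \<open>p\<close> closer to \<open>g\<close>. The polynomials \<open>q1\<close> and \<open>q2\<close>, close to \<open>\<psi>(p)\<close> and to its weighted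
  power, are the ones to which the inequality is applied.
\<close>

lemma shift_inequality_borel:
  fixes \<mu> :: "'a::{real_inner, second_countable_topology} measure"
  assumes \<mu>: "borel_prob \<mu>" and \<phi>: "character_positive \<phi>"
    and factor: "\<And>\<xi>. (\<integral>x. character x \<xi> \<partial>\<mu>) = \<phi> \<xi> * of_real (exp (- (\<xi> \<bullet> k)\<^sup>2 / 2))"
    and \<alpha>: "1 < \<alpha>" and \<beta>: "\<beta> = \<alpha> / (\<alpha> - 1)" and s: "0 < s"
    and g [measurable]: "g \<in> borel_measurable borel" and g0: "\<And>x. 0 \<le> g x" and gB: "\<And>x. g x \<le> B"
  shows "(\<integral>w. g (w + c *\<^sub>R k) \<partial>\<mu>)
       \<le> s / \<alpha> * (\<integral>w. g w powr \<alpha> \<partial>\<mu>) + s powr (1 - \<beta>) / \<beta> * exp ((\<beta>\<^sup>2 - \<beta>) * c\<^sup>2 / 2)"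
proof (rule le_if_le_add_small)
  interpret \<mu>: prob_space \<mu> using \<mu> unfolding borel_prob_def by blast
  have sets_\<mu> [measurable_cong]: "sets \<mu> = sets borel" using \<mu> unfolding borel_prob_def by blast
  define N where "N = distr \<mu> borel (\<lambda>w. w + c *\<^sub>R k)"
  have N: "prob_space N" unfolding N_def by (rule \<mu>.prob_space_distr) measurable
  interpret P: finite_borel_pair \<mu> N
    by (intro finite_borel_pair.intro finite_borel_pair_axioms.intro \<mu>.finite_measure_axioms sets_\<mu>
        prob_space.finite_measure N) (simp add: N_def)
  define L where "L = \<alpha> * (B + 1) powr (\<alpha> - 1)"
  have L: "0 \<le> L" unfolding L_def using \<alpha> by simp
  have B: "0 \<le> B" using g0 gB order_trans by blast
  show "0 \<le> 4 + 2 * (s / \<alpha> * L)" using s \<alpha> L by simp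
  fix \<epsilon> :: real assume \<epsilon>: "0 < \<epsilon>" "\<epsilon> \<le> 1"
  obtain p where p: "p \<in> trig_polys" and perr: "P.err (\<lambda>x. g x - p x) < \<epsilon>"
    using P.bounded_borel_approximable[OF g g0 gB] \<epsilon>(1) unfolding P.approximable_def by blast
  define \<psi> where "\<psi> t = min B (max 0 t)" for t
  have \<psi>: "continuous_on UNIV \<psi>" unfolding \<psi>_def by (intro continuous_intros)
  have \<psi>0: "0 \<le> \<psi> t" and \<psi>B: "\<psi> t \<le> B" for t unfolding \<psi>_def using B by auto
  have \<psi>g: "\<bar>\<psi> (p x) - g x\<bar> \<le> \<bar>g x - p x\<bar>" for x
    using g0[of x] gB[of x] unfolding \<psi>_def by (auto simp: min_def max_def)
  obtain q1 where q1: "q1 \<in> trig_polys" "\<And>x. \<bar>\<psi> (p x) - q1 x\<bar> \<le> \<epsilon>"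
    using trig_polys_approximation[OF p \<psi> \<epsilon>(1)] by blast
  \<comment> \<open>\<open>\<epsilon>\<close> is added inside and outside the power: this absorbs both approximation errors in \<open>q12\<close>\<close>
  have "continuous_on UNIV (\<lambda>t. s / \<alpha> * (\<psi> t + \<epsilon>) powr \<alpha> + \<epsilon>)"
    using \<psi>0 \<epsilon>(1) by (intro continuous_intros \<psi>) (metis add_nonneg_pos less_irrefl)
  from trig_polys_approximation[OF p this \<epsilon>(1)]
  obtain q2 where q2: "q2 \<in> trig_polys"
    "\<And>x. \<bar>s / \<alpha> * (\<psi> (p x) + \<epsilon>) powr \<alpha> + \<epsilon> - q2 x\<bar> \<le> \<epsilon>" by blast
  note [measurable] = trig_polys_measurable[OF p] trig_polys_measurable[OF q1(1)]
    trig_polys_measurable[OF q2(1)]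
  obtain K where K: "\<And>x. \<bar>p x\<bar> \<le> K" using trig_polys_bounded[OF p] by blast
  obtain K1 where K1: "\<And>x. \<bar>q1 x\<bar> \<le> K1" using trig_polys_bounded[OF q1(1)] by blast
  obtain K2 where K2: "\<And>x. \<bar>q2 x\<bar> \<le> K2" using trig_polys_bounded[OF q2(1)] by blast
  have s\<alpha>: "0 \<le> s / \<alpha>" using s \<alpha> by simp
  have q12: "s / \<alpha> * (max 0 (q1 x)) powr \<alpha> \<le> q2 x" for x
  proof -
    have "(max 0 (q1 x)) powr \<alpha> \<le> (\<psi> (p x) + \<epsilon>) powr \<alpha>"
      using q1(2)[of x] \<psi>0[of "p x"] \<epsilon>(1) \<alpha> by (intro powr_mono2) auto
    from mult_left_mono[OF this s\<alpha>] show ?thesis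
      by (rule order_trans) (use abs_le_D1[OF q2(2)[of x]] in simp)
  qed
  let ?C = "s powr (1 - \<beta>) / \<beta> * exp ((\<beta>\<^sup>2 - \<beta>) * c\<^sup>2 / 2)"
  have trig: "(\<integral>w. q1 (w + c *\<^sub>R k) \<partial>\<mu>) \<le> (\<integral>w. q2 w \<partial>\<mu>) + ?C"
    by (rule shift_inequality_trig_polys[OF \<mu> \<phi> factor \<alpha> \<beta> s q1(1) q2(1) q12])
  let ?d = "\<lambda>x. \<bar>g x - p x\<bar>"
  have dK: "\<bar>?d x\<bar> \<le> B + K" for x using g0[of x] gB[of x] K[of x] by linarith
  have di: "integrable \<mu> ?d" and diN: "integrable N ?d"
    by (rule P.integrable_bounded[of ?d, OF _ dK]; measurable)+
  have gi: "integrable N g"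
    by (rule P.integrable_bounded[of g B]) (use g0 gB in \<open>auto simp: abs_le_iff intro: order_trans\<close>)
  have gpi: "integrable \<mu> (\<lambda>x. g x powr \<alpha>)"
  proof (rule P.integrable_bounded[of _ "B powr \<alpha>"])
    show "\<bar>g x powr \<alpha>\<bar> \<le> B powr \<alpha>" for x using g0[of x] gB[of x] \<alpha> by (auto intro!: powr_mono2)
  qed measurable
  have q1i: "integrable N q1" by (rule P.integrable_bounded[of q1 K1]) (use K1 in auto)
  have q2i: "integrable \<mu> q2" by (rule P.integrable_bounded[of q2 K2]) (use K2 in auto)
  interpret N: prob_space N by (rule N)
  have shift: "(\<integral>x. h x \<partial>N) = (\<integral>w. h (w + c *\<^sub>R k) \<partial>\<mu>)" if "h \<in> borel_measurable borel" for h :: "'a \<Rightarrow> real"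
    unfolding N_def by (rule integral_distr) (use that in measurable)
  have "(\<integral>x. g x \<partial>N) \<le> (\<integral>x. (q1 x + ?d x) + \<epsilon> \<partial>N)"
  proof (rule integral_mono[OF gi])
    show "g x \<le> (q1 x + ?d x) + \<epsilon>" for x using \<psi>g[of x] q1(2)[of x] by linarith
  qed (intro Bochner_Integration.integrable_add q1i diN P.N.integrable_const)
  also have "\<dots> = (\<integral>x. q1 x \<partial>N) + (\<integral>x. ?d x \<partial>N) + \<epsilon>"
    using q1i diN by (simp add: N.prob_space)
  finally have up: "(\<integral>x. g x \<partial>N) \<le> (\<integral>x. q1 x \<partial>N) + (\<integral>x. ?d x \<partial>N) + \<epsilon>" .
  have "(\<integral>x. q2 x \<partial>\<mu>) \<le> (\<integral>x. s / \<alpha> * (g x powr \<alpha> + L * (?d x + \<epsilon>)) + 2 * \<epsilon> \<partial>\<mu>)"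
  proof (rule integral_mono[OF q2i])
    fix x
    have "(\<psi> (p x) + \<epsilon>) powr \<alpha> \<le> g x powr \<alpha> + L * \<bar>\<psi> (p x) + \<epsilon> - g x\<bar>"
      unfolding L_def using \<psi>0[of "p x"] \<psi>B[of "p x"] \<epsilon> g0[of x]
      by (intro powr_tangent_bound[OF \<alpha>]) auto
    also have "L * \<bar>\<psi> (p x) + \<epsilon> - g x\<bar> \<le> L * (?d x + \<epsilon>)"
      using L \<psi>g[of x] \<epsilon>(1) by (intro mult_left_mono) linarith+
    finally have "(\<psi> (p x) + \<epsilon>) powr \<alpha> \<le> g x powr \<alpha> + L * (?d x + \<epsilon>)" by simp
    from mult_left_mono[OF this s\<alpha>]
    have "s / \<alpha> * (\<psi> (p x) + \<epsilon>) powr \<alpha> + 2 * \<epsilon>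
        \<le> s / \<alpha> * (g x powr \<alpha> + L * (?d x + \<epsilon>)) + 2 * \<epsilon>" by (rule add_right_mono)
    moreover have "q2 x \<le> s / \<alpha> * (\<psi> (p x) + \<epsilon>) powr \<alpha> + 2 * \<epsilon>"
      using abs_le_D2[OF q2(2)[of x]] by simp
    ultimately show "q2 x \<le> s / \<alpha> * (g x powr \<alpha> + L * (?d x + \<epsilon>)) + 2 * \<epsilon>"
      by (rule order_trans[rotated])
  qed (intro Bochner_Integration.integrable_add integrable_mult_right gpi di \<mu>.integrable_const)
  also have "\<dots> = s / \<alpha> * ((\<integral>x. g x powr \<alpha> \<partial>\<mu>) + L * ((\<integral>x. ?d x \<partial>\<mu>) + \<epsilon>)) + 2 * \<epsilon>"
    using gpi di by (simp add: \<mu>.prob_space)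
  finally have low: "(\<integral>x. q2 x \<partial>\<mu>)
      \<le> s / \<alpha> * ((\<integral>x. g x powr \<alpha> \<partial>\<mu>) + L * ((\<integral>x. ?d x \<partial>\<mu>) + \<epsilon>)) + 2 * \<epsilon>" .
  have e: "(\<integral>x. ?d x \<partial>\<mu>) + (\<integral>x. ?d x \<partial>N) < \<epsilon>" using perr unfolding P.err_def .
  have d0: "0 \<le> (\<integral>x. ?d x \<partial>\<mu>)" "0 \<le> (\<integral>x. ?d x \<partial>N)" by simp_all
  have "s / \<alpha> * (L * ((\<integral>x. ?d x \<partial>\<mu>) + \<epsilon>)) \<le> s / \<alpha> * (L * (2 * \<epsilon>))"
    using e d0 s\<alpha> L by (intro mult_left_mono) linarith+
  then have "(\<integral>x. q2 x \<partial>\<mu>) \<le> s / \<alpha> * (\<integral>x. g x powr \<alpha> \<partial>\<mu>) + s / \<alpha> * (L * (2 * \<epsilon>)) + 2 * \<epsilon>"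
    using low by (simp add: distrib_left)
  moreover have "(\<integral>w. q1 (w + c *\<^sub>R k) \<partial>\<mu>) = (\<integral>x. q1 x \<partial>N)" "(\<integral>w. g (w + c *\<^sub>R k) \<partial>\<mu>) = (\<integral>x. g x \<partial>N)"
    by (simp_all add: shift)
  moreover have "\<epsilon> * (4 + 2 * (s / \<alpha> * L)) = 4 * \<epsilon> + s / \<alpha> * (L * (2 * \<epsilon>))"
    by (simp add: algebra_simps)
  ultimately show "(\<integral>w. g (w + c *\<^sub>R k) \<partial>\<mu>)
      \<le> s / \<alpha> * (\<integral>w. g w powr \<alpha> \<partial>\<mu>) + ?C + \<epsilon> * (4 + 2 * (s / \<alpha> * L))"
    using up trig e d0 by linarith
qed

text \<open>
  For \<open>G > 0\<close> the right-hand side is minimal at \<open>s\<^sup>\<beta> = exp e / G\<close>; for \<open>G = 0\<close> letting \<open>s\<close> tend to infinity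
  shows \<open>X = 0\<close>.
\<close>

lemma optimize_Young_parameter:
  fixes X G e \<alpha> \<beta> :: real
  assumes \<alpha>: "1 < \<alpha>" and \<beta>: "\<beta> = \<alpha> / (\<alpha> - 1)" and X: "0 \<le> X" and G: "0 \<le> G"
    and le: "\<And>s. 0 < s \<Longrightarrow> X \<le> s / \<alpha> * G + s powr (1 - \<beta>) / \<beta> * exp e"
  shows "X powr \<alpha> \<le> exp ((\<alpha> - 1) * e) * G"
proof (cases "G = 0")
  case True
  have \<beta>1: "1 < \<beta>" using \<alpha> unfolding \<beta> by (simp add: field_simps)
  have "X \<le> 0"
  proof (rule ccontr)
    assume "\<not> X \<le> 0"
    then have X0: "0 < X" by simp
    define r where "r = \<beta> * X / (2 * exp e)"
    have r: "0 < r" unfolding r_def using X0 \<beta>1 by simp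
    have "(r powr (1 / (1 - \<beta>))) powr (1 - \<beta>) = r"
      using r \<beta>1 by (simp add: powr_powr)
    then have "X \<le> r / \<beta> * exp e" using le[of "r powr (1 / (1 - \<beta>))"] r True by simp
    then show False using X0 \<beta>1 unfolding r_def by simp
  qed
  then show ?thesis using X True by simp
next
  case False
  then have "0 < G" using G by simp
  then obtain \<gamma> where \<gamma>: "G = exp \<gamma>" by (metis exp_ln)
  define \<tau> where "\<tau> = (e - \<gamma>) / \<beta> + \<gamma>"
  have \<beta>1: "1 < \<beta>" using \<alpha> unfolding \<beta> by (simp add: field_simps)
  have conj: "1 / \<alpha> + 1 / \<beta> = 1" using \<alpha> unfolding \<beta> by (simp add: field_simps)
  have a1: "exp ((e - \<gamma>) / \<beta>) * G = exp \<tau>" unfolding \<gamma> \<tau>_def by (simp add: mult_exp_exp)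
  have a2: "exp ((e - \<gamma>) / \<beta>) powr (1 - \<beta>) * exp e = exp \<tau>"
  proof -
    have "(1 - \<beta>) * ((e - \<gamma>) / \<beta>) + e = \<tau>" unfolding \<tau>_def using \<beta>1 by (simp add: field_simps)
    then show ?thesis by (simp add: powr_def mult_exp_exp)
  qed
  have "X \<le> exp ((e - \<gamma>) / \<beta>) / \<alpha> * G + exp ((e - \<gamma>) / \<beta>) powr (1 - \<beta>) / \<beta> * exp e"
    by (rule le) simp
  also have "\<dots> = exp \<tau> * (1 / \<alpha> + 1 / \<beta>)" using a1 a2 by (simp add: distrib_left)
  finally have "X \<le> exp \<tau>" unfolding conj by simp
  then have "X powr \<alpha> \<le> exp \<tau> powr \<alpha>" using X \<alpha> by (intro powr_mono2) auto
  also have "\<dots> = exp ((\<alpha> - 1) * e) * G"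
  proof -
    have "\<alpha> * \<tau> = (\<alpha> - 1) * e + \<gamma>"
      unfolding \<tau>_def \<beta> using \<alpha> by (simp add: field_simps)
    then show ?thesis by (simp add: powr_def \<gamma> mult_exp_exp)
  qed
  finally show ?thesis .
qed

text \<open>
  With \<open>e = z / |z|\<close> the shift is \<open>|z|\<close> times \<open>R\<^sup>1\<^sup>/\<^sup>2 e\<close>, a direction along
  which \<open>\<mu>\<close> has a standard normal factor. The
  exponent comes from \<open>(\<alpha> - 1) (\<beta>\<^sup>2 - \<beta>) = \<alpha> / (\<alpha> - 1)\<close>. For \<open>z = 0\<close> division by zero
  gives \<open>e = 0\<close>.
\<close>

theorem shift_power_inequality:
  fixes \<mu> m :: "'a::{real_inner, complete_space, second_countable_topology} measure"
  assumes \<mu>: "has_levy_triplet \<mu> a R m" and \<alpha>: "1 < \<alpha>"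
    and g: "g \<in> borel_measurable borel" and g0: "\<And>x. 0 \<le> g x" and gB: "\<And>x. g x \<le> B"
  shows "(\<integral>w. g (w + op_sqrt R z) \<partial>\<mu>) powr \<alpha>
    \<le> exp (\<alpha> * (norm z)\<^sup>2 / (2 * (\<alpha> - 1))) * (\<integral>w. g w powr \<alpha> \<partial>\<mu>)"
proof -
  define \<beta> where "\<beta> = \<alpha> / (\<alpha> - 1)"
  define e where "e = z /\<^sub>R norm z"
  have e: "e = 0 \<or> norm e = 1" by (cases "z = 0") (simp_all add: e_def)
  have "norm z *\<^sub>R e = z"
  proof (cases "z = 0")
    case False
    then have "norm z * inverse (norm z) = 1" by simp
    then show ?thesis unfolding e_def by (simp only: scaleR_scaleR scaleR_one)
  qed (simp add: e_def)
  then have z: "norm z *\<^sub>R op_sqrt R e = op_sqrt R z"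
    using blinfun.scaleR_right[of "op_sqrt R" "norm z" e] by simp
  have prob: "borel_prob \<mu>" using \<mu> unfolding has_levy_triplet_def infinitely_divisible_def by blast
  obtain \<phi> where \<phi>: "character_positive \<phi>"
    and f: "\<And>\<xi>. (\<integral>x. character x \<xi> \<partial>\<mu>) = \<phi> \<xi> * of_real (exp (- (\<xi> \<bullet> op_sqrt R e)\<^sup>2 / 2))"
    using character_positive_levy_quotient[OF \<mu> e] by blast
  have "(\<integral>w. g (w + op_sqrt R z) \<partial>\<mu>) powr \<alpha>
      \<le> exp ((\<alpha> - 1) * ((\<beta>\<^sup>2 - \<beta>) * (norm z)\<^sup>2 / 2)) * (\<integral>w. g w powr \<alpha> \<partial>\<mu>)"
  proof (rule optimize_Young_parameter[OF \<alpha> \<beta>_def])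
    show "0 \<le> (\<integral>w. g (w + op_sqrt R z) \<partial>\<mu>)" "0 \<le> (\<integral>w. g w powr \<alpha> \<partial>\<mu>)" using g0 by simp_all
    fix s :: real assume "0 < s"
    from shift_inequality_borel[OF prob \<phi> f \<alpha> \<beta>_def this g g0 gB, of "norm z"]
    show "(\<integral>w. g (w + op_sqrt R z) \<partial>\<mu>) \<le> s / \<alpha> * (\<integral>w. g w powr \<alpha> \<partial>\<mu>)
        + s powr (1 - \<beta>) / \<beta> * exp ((\<beta>\<^sup>2 - \<beta>) * (norm z)\<^sup>2 / 2)" unfolding z .
  qed
  also have "(\<alpha> - 1) * ((\<beta>\<^sup>2 - \<beta>) * (norm z)\<^sup>2 / 2) = \<alpha> * (norm z)\<^sup>2 / (2 * (\<alpha> - 1))"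
  proof -
    have "(\<alpha> - 1) * (\<beta>\<^sup>2 - \<beta>) = \<alpha> / (\<alpha> - 1)"
    proof -
      have "(\<alpha> - 1) * \<beta> = \<alpha>" and "\<beta> - 1 = 1 / (\<alpha> - 1)"
        unfolding \<beta>_def using \<alpha> by (simp_all add: field_simps)
      moreover have "(\<alpha> - 1) * (\<beta>\<^sup>2 - \<beta>) = ((\<alpha> - 1) * \<beta>) * (\<beta> - 1)"
        by (simp add: power2_eq_square algebra_simps)
      ultimately show ?thesis by simp
    qed
    moreover have "(\<alpha> - 1) * ((\<beta>\<^sup>2 - \<beta>) * (norm z)\<^sup>2 / 2) = ((\<alpha> - 1) * (\<beta>\<^sup>2 - \<beta>)) * (norm z)\<^sup>2 / 2"
      by (simp only: mult.assoc times_divide_eq_right)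
    ultimately show ?thesis
      by (simp only: times_divide_eq_left divide_divide_eq_left mult.commute[of 2])
  qed
  finally show ?thesis .
qed

theorem theorem5p2:
  fixes U :: "real \<Rightarrow> real \<Rightarrow>
      'a::{real_inner, complete_space, second_countable_topology} \<Rightarrow>\<^sub>L 'a"
    and \<mu> m :: "real \<Rightarrow> real \<Rightarrow> 'a measure"
    and a :: "real \<Rightarrow> real \<Rightarrow> 'a"
    and R :: "real \<Rightarrow> real \<Rightarrow> 'a \<Rightarrow>\<^sub>L 'a"
    and f :: "'a \<Rightarrow> real"
    and \<alpha> s t :: real
    and x y :: 'a
  assumes "evolution_family U"
    and "\<And>t s. s \<le> t \<Longrightarrow> has_levy_triplet (\<mu> t s) (a t s) (R t s) (m t s)"
    and "\<And>t r s. s \<le> r \<Longrightarrow> r \<le> t \<Longrightarrow>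
           \<mu> t s = conv (\<mu> t r) (distr (\<mu> r s) borel (blinfun_apply (U t r)))"
    and "1 < \<alpha>" and "s \<le> t"
    and "f \<in> borel_measurable borel" and "bounded (range f)" and "\<And>z. 0 \<le> f z"
  shows "ennreal (mehler U \<mu> s t f x powr \<alpha>) \<le>
    (if x - y \<in> Gamma_dom U R t s
     then ennreal (exp (\<alpha> * (norm (Gamma_op U R t s (x - y)))\<^sup>2 / (2 * (\<alpha> - 1)))
                   * mehler U \<mu> s t (\<lambda>z. f z powr \<alpha>) y)
     else \<infinity>)"
proof (cases "x - y \<in> Gamma_dom U R t s")
  case True
  let ?z = "Gamma_op U R t s (x - y)"
  have "op_sqrt (R t s) ?z = U t s (x - y)"
    unfolding Gamma_op_def by (rule pseudo_inverse_preimage) (use True in \<open>simp add: Gamma_dom_def\<close>)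
  then have shift: "U t s x + w = U t s y + (w + op_sqrt (R t s) ?z)" for w
    by (simp add: blinfun.diff_right)
  obtain B where B: "\<And>z. f z \<le> B"
    using \<open>bounded (range f)\<close> unfolding bounded_real by (auto simp: abs_le_iff)
  have "(\<integral>w. f (U t s y + (w + op_sqrt (R t s) ?z)) \<partial>\<mu> t s) powr \<alpha>
      \<le> exp (\<alpha> * (norm ?z)\<^sup>2 / (2 * (\<alpha> - 1))) * (\<integral>w. f (U t s y + w) powr \<alpha> \<partial>\<mu> t s)"
  proof (rule shift_power_inequality[OF assms(2)[OF \<open>s \<le> t\<close>] \<open>1 < \<alpha>\<close>, where g = "\<lambda>w. f (U t s y + w)"])
    show "(\<lambda>w. f (U t s y + w)) \<in> borel_measurable borel"
      using \<open>f \<in> borel_measurable borel\<close> by measurable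
  qed (use assms(8) B in auto)
  then have "mehler U \<mu> s t f x powr \<alpha>
      \<le> exp (\<alpha> * (norm ?z)\<^sup>2 / (2 * (\<alpha> - 1))) * mehler U \<mu> s t (\<lambda>z. f z powr \<alpha>) y"
    unfolding mehler_def shift[symmetric] .
  then show ?thesis using True by (simp add: ennreal_leI)
next
  case False
  then show ?thesis by simp
qed

end
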